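(* Let $L\ge 0$, $\delta>0$ and $\varepsilon$ be real numbers. If $f$ is $L$-Lipschitz for the metric $d_n$ and satisfies $$\mathrm{cov}_{\delta n}\Big(\Big\{\nabla f(\boldsymbol{x},\cdot):\ \boldsymbol{x} \in \prod_{i=1}^n K_i\Big\},\|\cdot\|\Big) \leq e^{\varepsilon n},$$ then $$\log \int e^f\,d\lambda \leq \sup_\xi\Big[\int f\,d\xi - \mathrm{D}(\xi\,\|\,\lambda)\Big] + (\varepsilon + \delta)n + \sqrt{\frac{\varepsilon + \delta}{2}}\,L,$$ where the supremum runs over product (Borel probability) measures $\xi$ on $\prod_{i=1}^n K_i$.
   Context: Setting. Let $n\ge 1$ and $[n]=\{1,\dots,n\}$. Let $(K_1,d_{K_1}),\dots,(K_n,d_{K_n})$ be nonempty, complete, separable metric spaces, all of diameter at most one. For each $i$ let $\lambda_i$ be a fixed Borel probability measure on $K_i$ and $\ast_i\in K_i$ a fixed reference point, and let $\lambda:=\lambda_1\times\cdots\times\lambda_n$. Let $f:\prod_{i=1}^n K_i\to\mathbb{R}$ be bounded and continuous. $\|\cdot\|$ denotes the uniform (sup) norm. $d_n(\boldsymbol{x},\boldsymbol{y}):=\frac1n\sum_{i=1}^nd_{K_i}(x_i,y_i)$. Discrete gradient. For $\boldsymbol{x}\in\prod_iK_i$, $i\in[n]$, $y\in K_i$, put $\partial_i f(\boldsymbol{x},y) := f(x_1,\dots,x_{i-1},y,x_{i+1},\dots,x_n) - f(x_1,\dots,x_{i-1},\ast_i,x_{i+1},\dots,x_n)$, and for $\boldsymbol{x},\boldsymbol{y}\in\prod_iK_i$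 put $\nabla f(\boldsymbol{x},\boldsymbol{y}) := \sum_{i=1}^n\partial_if(\boldsymbol{x},y_i)$. Covering numbers. For a set $F$ of bounded functions on $\prod_i K_i$, $\mathrm{cov}_{\delta n}(F,\|\cdot\|)$ is the smallest cardinality of a covering of $F$ by sets of $\|\cdot\|$-diameter less than $\delta n$. Kullback--Leibler divergence. $\mathrm{D}(\nu\|\gamma)=\int\log\frac{d\nu}{d\gamma}\,d\nu$ (natural logarithm) if $\nu\ll\gamma$ and $+\infty$ otherwise. *)

theory Defs
  imports "HOL-Probability.Probability"
begin

definition borel_of :: "'a topology \<Rightarrow> 'a measure" where
  "borel_of X = sigma (topspace X) {U. openin X U}"

text \<open>The factors are \<open>K 1, \<dots>, K n\<close>; points of the product are the functions in
  \<open>\<Pi>\<^sub>E i\<in>{1..n}. mspace (K i)\<close>, which are \<open>undefined\<close> off \<open>{1..n}\<close>.\<close>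

abbreviation prod_mspace :: "nat \<Rightarrow> (nat \<Rightarrow> 'a metric) \<Rightarrow> (nat \<Rightarrow> 'a) set" where
  "prod_mspace n K \<equiv> (\<Pi>\<^sub>E i\<in>{1..n}. mspace (K i))"

abbreviation prod_mtopology :: "nat \<Rightarrow> (nat \<Rightarrow> 'a metric) \<Rightarrow> (nat \<Rightarrow> 'a) topology" where
  "prod_mtopology n K \<equiv> product_topology (\<lambda>i. mtopology_of (K i)) {1..n}"

definition avg_dist :: "nat \<Rightarrow> (nat \<Rightarrow> 'a metric) \<Rightarrow> (nat \<Rightarrow> 'a) \<Rightarrow> (nat \<Rightarrow> 'a) \<Rightarrow> real" where
  "avg_dist n K x y = 1 / real n * (\<Sum>i=1..n. mdist (K i) (x i) (y i))"

definition partial_diff ::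
    "(nat \<Rightarrow> 'a) \<Rightarrow> ((nat \<Rightarrow> 'a) \<Rightarrow> real) \<Rightarrow> nat \<Rightarrow> (nat \<Rightarrow> 'a) \<Rightarrow> 'a \<Rightarrow> real" where
  "partial_diff base f i x y = f (x(i := y)) - f (x(i := base i))"

definition discrete_grad ::
    "nat \<Rightarrow> (nat \<Rightarrow> 'a) \<Rightarrow> ((nat \<Rightarrow> 'a) \<Rightarrow> real) \<Rightarrow> (nat \<Rightarrow> 'a) \<Rightarrow> (nat \<Rightarrow> 'a) \<Rightarrow> real" where
  "discrete_grad n base f x y = (\<Sum>i=1..n. partial_diff base f i x (y i))"

text \<open>Suprema in \<^typ>\<open>ennreal\<close>: an unbounded set has diameter \<open>\<infinity>\<close>, the empty set diameter 0.\<close>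

definition mdiameter :: "'a metric \<Rightarrow> 'a set \<Rightarrow> ennreal" where
  "mdiameter m S = (SUP x\<in>S. SUP y\<in>S. ennreal (mdist m x y))"

text \<open>The value is \<open>\<infinity>\<close> if there is no finite covering. The covering sets have to lie in
  \<open>mspace m\<close>, since \<open>mdist m\<close> carries no information elsewhere.\<close>

definition covering_number :: "'a metric \<Rightarrow> real \<Rightarrow> 'a set \<Rightarrow> enat" where
  "covering_number m r F =
     (INF C \<in> {C. finite C \<and> F \<subseteq> \<Union>C \<and> (\<forall>S\<in>C. S \<subseteq> mspace m \<and> mdiameter m S < ennreal r)}.
        enat (card C))"

text \<open>\<open>D(\<nu>\<parallel>\<gamma>)\<close>; note that \<open>entropy_density b \<gamma> \<nu>\<close> and \<open>KL_divergence b \<gamma> \<nu>\<close>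
  take the reference measure first. \<^const>\<open>KL_divergence\<close> itself is real-valued
  and returns 0 when the integral diverges. Here the integral of \<open>log (d\<nu>/d\<gamma>)\<close>
  is the extended one: positive minus negative part, the latter being finite for
  probability measures with \<open>\<nu> \<lless> \<gamma>\<close>.\<close>

definition kl_div :: "'a measure \<Rightarrow> 'a measure \<Rightarrow> ereal" where
  "kl_div \<nu> \<gamma> =
     (if absolutely_continuous \<gamma> \<nu>
      then enn2ereal (\<integral>\<^sup>+ x. ennreal (entropy_density (exp 1) \<gamma> \<nu> x) \<partial>\<nu>)
         - enn2ereal (\<integral>\<^sup>+ x. ennreal (- entropy_density (exp 1) \<gamma> \<nu> x) \<partial>\<nu>)
      else \<infinity>)"

lemma kl_div_eq_KL_divergence:
  assumes "absolutely_continuous \<gamma> \<nu>" "integrable \<nu> (entropy_density (exp 1) \<gamma> \<nu>)"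
  shows "kl_div \<nu> \<gamma> = ereal (KL_divergence (exp 1) \<gamma> \<nu>)"
proof -
  let ?g = "entropy_density (exp 1) \<gamma> \<nu>"
  have fin: "(\<integral>\<^sup>+ x. ennreal (?g x) \<partial>\<nu>) \<noteq> \<infinity>" "(\<integral>\<^sup>+ x. ennreal (- ?g x) \<partial>\<nu>) \<noteq> \<infinity>"
    using real_integrable_def[of \<nu> ?g] assms(2) by auto
  have *: "enn2ereal a = ereal (enn2real a)" if "a \<noteq> \<infinity>" for a
    using that by (cases a rule: ennreal_cases) (auto simp: enn2ereal_ennreal)
  show ?thesis
    using assms fin by (simp add: kl_div_def KL_divergence_def real_lebesgue_integral_def *)
qed

text \<open>Products of Borel probability measures. As the factors are separable, the product
  \<open>\<sigma>\<close>-algebra is the Borel \<open>\<sigma>\<close>-algebra of the product topology.\<close>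

definition product_prob_measures :: "nat \<Rightarrow> (nat \<Rightarrow> 'a metric) \<Rightarrow> (nat \<Rightarrow> 'a) measure set" where
  "product_prob_measures n K =
     {Pi\<^sub>M {1..n} \<nu> | \<nu>. \<forall>i\<in>{1..n}. prob_space (\<nu> i) \<and>
        sets (\<nu> i) = sets (borel_of (mtopology_of (K i)))}"

end

theory Submission
  imports Defs
begin

text \<open>
  Let \<open>\<mu>\<close> be the Gibbs measure proportional to \<open>exp f \<cdot> \<lambda>\<close>. Split the space into at most
  \<open>exp (\<epsilon> n)\<close> cells on which \<open>\<nabla>f(x, \<sqdot>)\<close> varies by less than \<open>\<delta> n\<close>; conditioning \<open>\<mu>\<close> on a cell \<open>j\<close>
  gives \<open>\<mu> = \<Sum>\<^sub>j p\<^sub>j \<mu>\<^sub>j\<close>, and the entropy of \<open>p\<close> is at most \<open>\<epsilon> n\<close>. Let \<open>\<xi>\<^sub>j\<close> be the product of the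
  marginals of \<open>\<mu>\<^sub>j\<close> and \<open>T\<^sub>j = D(\<mu>\<^sub>j \<parallel> \<xi>\<^sub>j)\<close> its total correlation, so that
  \<open>D(\<mu>\<^sub>j \<parallel> \<lambda>) = T\<^sub>j + D(\<xi>\<^sub>j \<parallel> \<lambda>)\<close>. Since \<open>T\<^sub>j\<close> is at most the divergence of \<open>\<mu>\<^sub>j\<close> from the product
  measure proportional to \<open>exp (\<nabla>f(x', \<sqdot>)) \<cdot> \<lambda>\<close> with \<open>x'\<close> in the cell, Han's inequality for \<open>\<mu>\<close>
  yields \<open>\<Sum>\<^sub>j p\<^sub>j T\<^sub>j \<le> (\<epsilon> + \<delta>) n\<close>. Finally, the Gibbs variational principle together with
  McDiarmid's exponential bound gives
  \<open>\<integral>f d\<mu>\<^sub>j - \<integral>f d\<xi>\<^sub>j \<le> T\<^sub>j / t + t L\<^sup>2 / (8 n)\<close> for all \<open>t > 0\<close>, which is linear in \<open>T\<^sub>j\<close>: average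
  over \<open>j\<close> and optimise \<open>t\<close>.
\<close>

section \<open>Bounded Borel functions and relative entropy\<close>

text \<open>A class closed under sums, products and \<open>exp\<close> whose members are integrable
  for every finite measure on the space, so that integrability conditions become syntactic. The
  bound is pointwise, not almost everywhere, and so survives restriction to fibres.\<close>

definition bounded_borel :: "'a measure \<Rightarrow> ('a \<Rightarrow> real) \<Rightarrow> bool" where
  "bounded_borel N g \<longleftrightarrow> g \<in> borel_measurable N \<and> (\<exists>B. \<forall>x\<in>space N. \<bar>g x\<bar> \<le> B)"

lemma bounded_borelI:
  "g \<in> borel_measurable N \<Longrightarrow> (\<And>x. x \<in> space N \<Longrightarrow> \<bar>g x\<bar> \<le> B) \<Longrightarrow> bounded_borel N g"
  unfolding bounded_borel_def by blast

lemma bounded_borelE: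
  assumes "bounded_borel N g"
  obtains B where "B > 0" "\<And>x. x \<in> space N \<Longrightarrow> \<bar>g x\<bar> \<le> B"
proof -
  from assms obtain B where "\<forall>x\<in>space N. \<bar>g x\<bar> \<le> B" unfolding bounded_borel_def by blast
  then show ?thesis using that[of "max 1 B"] by force
qed

lemma bounded_borel_measurable: "bounded_borel N g \<Longrightarrow> g \<in> borel_measurable N"
  unfolding bounded_borel_def by blast

lemma bounded_borel_const [intro!, simp]: "bounded_borel N (\<lambda>x. c)"
  by (rule bounded_borelI[of _ _ "\<bar>c\<bar>"]) auto

lemma bounded_borel_compose_continuous:
  assumes "bounded_borel N g" and "continuous_on UNIV h"
  shows "bounded_borel N (\<lambda>x. h (g x))"
proof -
  obtain B where B: "\<And>x. x \<in> space N \<Longrightarrow> \<bar>g x\<bar> \<le> B" by (rule bounded_borelE[OF assms(1)]) blast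
  have "compact (h ` {-B..B})"
    by (rule compact_continuous_image) (use assms(2) continuous_on_subset in auto)
  then have "bounded (h ` {-B..B})" by (rule compact_imp_bounded)
  then obtain C where C: "\<forall>y\<in>{-B..B}. \<bar>h y\<bar> \<le> C"
    by (auto simp: bounded_iff)
  show ?thesis
  proof (rule bounded_borelI)
    show "(\<lambda>x. h (g x)) \<in> borel_measurable N"
      using bounded_borel_measurable[OF assms(1)] borel_measurable_continuous_onI[OF assms(2)] by simp
    show "\<And>x. x \<in> space N \<Longrightarrow> \<bar>h (g x)\<bar> \<le> C" using B C by (force simp: abs_le_iff)
  qed
qed

lemma bounded_borel_add [intro!]:
  assumes "bounded_borel N g" "bounded_borel N h" shows "bounded_borel N (\<lambda>x. g x + h x)"
proof -
  obtain B where "\<And>x. x \<in> space N \<Longrightarrow> \<bar>g x\<bar> \<le> B" by (rule bounded_borelE[OF assms(1)]) blast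
  moreover obtain C where "\<And>x. x \<in> space N \<Longrightarrow> \<bar>h x\<bar> \<le> C" by (rule bounded_borelE[OF assms(2)]) blast
  ultimately show ?thesis using assms[THEN bounded_borel_measurable]
    by (intro bounded_borelI[of _ _ "B + C"]) (auto intro!: order.trans[OF abs_triangle_ineq] add_mono)
qed

lemma bounded_borel_mult [intro!]:
  assumes "bounded_borel N g" "bounded_borel N h" shows "bounded_borel N (\<lambda>x. g x * h x)"
proof -
  obtain B where "B > 0" "\<And>x. x \<in> space N \<Longrightarrow> \<bar>g x\<bar> \<le> B" by (rule bounded_borelE[OF assms(1)]) blast
  moreover obtain C where "C > 0" "\<And>x. x \<in> space N \<Longrightarrow> \<bar>h x\<bar> \<le> C" by (rule bounded_borelE[OF assms(2)]) blast
  ultimately show ?thesis using assms[THEN bounded_borel_measurable]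
    by (intro bounded_borelI[of _ _ "B * C"])
      (auto simp: abs_mult intro!: mult_mono)
qed

lemma bounded_borel_cmult: "bounded_borel N g \<Longrightarrow> bounded_borel N (\<lambda>x. c * g x)"
  by (rule bounded_borel_mult) auto

lemma bounded_borel_divide [intro!]: "bounded_borel N g \<Longrightarrow> bounded_borel N (\<lambda>x. g x / c)"
  using bounded_borel_cmult[of N g "1 / c"] by simp

lemma bounded_borel_uminus [intro!]: "bounded_borel N g \<Longrightarrow> bounded_borel N (\<lambda>x. - g x)"
  using bounded_borel_cmult[of N g "-1"] by simp

lemma bounded_borel_diff [intro!]:
  "bounded_borel N g \<Longrightarrow> bounded_borel N h \<Longrightarrow> bounded_borel N (\<lambda>x. g x - h x)"
  using bounded_borel_add[OF _ bounded_borel_uminus] by fastforce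

lemma bounded_borel_sum [intro!]:
  "(\<And>i. i \<in> A \<Longrightarrow> bounded_borel N (g i)) \<Longrightarrow> bounded_borel N (\<lambda>x. \<Sum>i\<in>A. g i x)"
  by (induction A rule: infinite_finite_induct) auto

lemma bounded_borel_prod [intro!]:
  "(\<And>i. i \<in> A \<Longrightarrow> bounded_borel N (g i)) \<Longrightarrow> bounded_borel N (\<lambda>x. \<Prod>i\<in>A. g i x)"
  by (induction A rule: infinite_finite_induct) auto

lemma bounded_borel_exp [intro!]: "bounded_borel N g \<Longrightarrow> bounded_borel N (\<lambda>x. exp (g x))"
  by (rule bounded_borel_compose_continuous) (auto intro: continuous_intros)

lemma bounded_borel_indicator [intro!]: "A \<in> sets N \<Longrightarrow> bounded_borel N (indicator A)"
  by (rule bounded_borelI[of _ _ 1]) (auto simp: indicator_def)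

lemma abs_ln_le:
  fixes x c C :: real
  assumes "0 < c" "c \<le> x" "x \<le> C"
  shows "\<bar>ln x\<bar> \<le> max \<bar>ln c\<bar> \<bar>ln C\<bar>"
proof -
  have "ln c \<le> ln x" "ln x \<le> ln C" using assms by auto
  then show ?thesis by linarith
qed

lemma bounded_borel_ln:
  assumes "bounded_borel N g" "0 < c" "\<And>x. x \<in> space N \<Longrightarrow> c \<le> g x"
  shows "bounded_borel N (\<lambda>x. ln (g x))"
proof -
  obtain B where B: "\<And>x. x \<in> space N \<Longrightarrow> \<bar>g x\<bar> \<le> B" by (rule bounded_borelE[OF assms(1)]) blast
  show ?thesis
    using bounded_borel_measurable[OF assms(1)] abs_ln_le[OF assms(2,3)] B
    by (intro bounded_borelI[of _ _ "max \<bar>ln c\<bar> \<bar>ln B\<bar>"]) (auto simp: abs_le_iff)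
qed

text \<open>Unlike \<open>ln\<close> itself, \<open>s * ln s\<close> stays bounded down to
  \<open>s = 0\<close>, so densities may vanish. The bounds \<open>-1\<close> and
  \<open>B * B\<close> come from \<open>ln z \<le> z - 1\<close> at \<open>z = 1 / s\<close> and at
  \<open>z = s\<close>.\<close>

lemma bounded_borel_mult_ln:
  assumes "bounded_borel N g" "\<And>x. x \<in> space N \<Longrightarrow> 0 \<le> g x"
  shows "bounded_borel N (\<lambda>x. g x * ln (g x))"
proof -
  obtain B where B: "B > 0" "\<And>x. x \<in> space N \<Longrightarrow> \<bar>g x\<bar> \<le> B" by (rule bounded_borelE[OF assms(1)]) blast
  have "\<bar>s * ln s\<bar> \<le> 1 + B * B" if "0 \<le> s" "s \<le> B" for s
  proof (cases "s = 0")
    case False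
    then have s: "s > 0" using that by simp
    have "s * ln s \<le> s * (s - 1)" using s ln_le_minus_one[of s] by (intro mult_left_mono) auto
    also have "\<dots> \<le> B * B" using that s by (intro order.trans[OF _ mult_mono[of s B s B]]) (auto simp: algebra_simps)
    finally have 1: "s * ln s \<le> B * B" .
    have "s * (- ln s) \<le> s * (1 / s - 1)"
      using s ln_le_minus_one[of "1 / s"] by (intro mult_left_mono) (auto simp: ln_div)
    also have "\<dots> \<le> 1" using s by (simp add: algebra_simps)
    finally have "- (s * ln s) \<le> 1" by simp
    then show ?thesis using 1 B by (smt (verit) mult_pos_pos)
  qed (simp add: B)
  then show ?thesis
    using bounded_borel_measurable[OF assms(1)] assms(2) B
    by (intro bounded_borelI[of _ _ "1 + B * B"]) (auto simp: abs_le_iff)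
qed

lemma bounded_borel_comp:
  "bounded_borel N g \<Longrightarrow> h \<in> measurable N' N \<Longrightarrow> bounded_borel N' (\<lambda>x. g (h x))"
  unfolding bounded_borel_def by (metis measurable_compose measurable_space)

lemma (in finite_measure) bounded_borel_integrable: "bounded_borel M g \<Longrightarrow> integrable M g"
  by (metis AE_I2 bounded_borelE bounded_borel_measurable integrable_const_bound real_norm_def)

lemma (in prob_space) integral_lower_bound:
  assumes "bounded_borel M g" "\<And>x. x \<in> space M \<Longrightarrow> c \<le> g x"
  shows "c \<le> integral\<^sup>L M g"
  using integral_mono[of M "\<lambda>_. c" g] assms bounded_borel_integrable by (auto simp: prob_space)

lemma (in prob_space) integral_upper_bound:
  assumes "bounded_borel M g" "\<And>x. x \<in> space M \<Longrightarrow> g x \<le> c"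
  shows "integral\<^sup>L M g \<le> c"
  using integral_mono[of M g "\<lambda>_. c"] assms bounded_borel_integrable by (auto simp: prob_space)

lemma bounded_borel_cong_sets: "sets N = sets N' \<Longrightarrow> bounded_borel N g \<longleftrightarrow> bounded_borel N' g"
  unfolding bounded_borel_def using measurable_cong_sets[of N N' borel borel] sets_eq_imp_space_eq[of N N'] by auto

section \<open>Relative entropy of bounded densities and the Gibbs variational principle\<close>

text \<open>The Radon-Nikodym derivative equals \<open>r\<close> almost everywhere, and boundedness
  of \<open>r ln r\<close> gives the integrability under which the extended divergence is an
  ordinary integral.\<close>

lemma (in finite_measure) kl_div_density:
  assumes r: "bounded_borel M r" "\<And>x. x \<in> space M \<Longrightarrow> 0 \<le> r x"
  shows "kl_div (density M r) M = ereal (\<integral>x. r x * ln (r x) \<partial>M)"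
proof -
  note [measurable] = bounded_borel_measurable[OF r(1)]
  have [simp]: "log (exp 1) = (ln :: real \<Rightarrow> real)" by (auto simp: log_def)
  have nn: "AE x in M. 0 \<le> r x" using r(2) by auto
  have "density M (RN_deriv M (density M r)) = density M r"
    by (intro density_RN_deriv_density) auto
  then have eq: "AE x in M. RN_deriv M (density M r) x = r x"
    by (intro density_unique) auto
  have "AE x in M. r x * entropy_density (exp 1) M (density M r) x = r x * ln (r x)"
    using eq nn by (auto simp: entropy_density_def)
  moreover have [measurable]: "entropy_density (exp 1) M (density M (\<lambda>x. ennreal (r x))) \<in> borel_measurable M"
    by (auto simp: comp_def entropy_density_def)
  moreover have "integrable M (\<lambda>x. r x * ln (r x))"
    using bounded_borel_mult_ln[OF r] by (rule bounded_borel_integrable)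
  ultimately have "integrable M (\<lambda>x. r x * entropy_density (exp 1) M (density M r) x)"
    by (subst integrable_cong_AE) auto
  then have "integrable (density M r) (entropy_density (exp 1) M (density M r))"
    using nn by (subst integrable_real_density) auto
  moreover have "absolutely_continuous M (density M r)"
    by (intro absolutely_continuousI_density) auto
  ultimately have "kl_div (density M r) M = ereal (KL_divergence (exp 1) M (density M r))"
    by (intro kl_div_eq_KL_divergence)
  also have "KL_divergence (exp 1) M (density M r) = (\<integral>x. r x * ln (r x) \<partial>M)"
    using nn by (subst KL_density) auto
  finally show ?thesis .
qed

text \<open>The gap between the two sides is the relative entropy of \<open>m\<close> with respect
  to the probability density \<open>exp s / W\<close>, hence nonnegative.\<close>

lemma (in prob_space) donsker_varadhan:
  assumes m: "bounded_borel M m" "\<And>x. x \<in> space M \<Longrightarrow> 0 \<le> m x" "(\<integral>x. m x \<partial>M) = 1"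
    and s: "bounded_borel M s"
  shows "(\<integral>x. m x * s x \<partial>M) - (\<integral>x. m x * ln (m x) \<partial>M) \<le> ln (\<integral>x. exp (s x) \<partial>M)"
proof -
  define W where "W = (\<integral>x. exp (s x) \<partial>M)"
  obtain B where B: "\<And>x. x \<in> space M \<Longrightarrow> \<bar>s x\<bar> \<le> B" by (rule bounded_borelE[OF s]) blast
  have "exp (- B) \<le> W"
    unfolding W_def using s B by (intro integral_lower_bound) (auto simp: abs_le_iff minus_le_iff)
  then have W: "W > 0" by (metis exp_gt_zero less_le_trans)
  note int = bounded_borel_integrable
  have ml: "bounded_borel M (\<lambda>x. m x * ln (m x))" by (rule bounded_borel_mult_ln[OF m(1,2)])
  \<comment> \<open>This is \<open>ln z \<le> z - 1\<close> at \<open>z = exp c / (W * a)\<close>.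
    The right-hand side will integrate to 0, because \<open>exp s / W\<close> and \<open>m\<close>
    both have integral 1.\<close>
  have pointwise: "a * c - a * ln W - a * ln a \<le> exp c / W - a" if "a \<ge> 0" for a c :: real
  proof (cases "a = 0")
    case True
    then show ?thesis using W by simp
  next
    case False
    then have a: "a > 0" using that by simp
    have "a * ln (exp c / W / a) \<le> a * (exp c / W / a - 1)"
      using a W by (intro mult_left_mono ln_le_minus_one) auto
    moreover have "ln (exp c / W / a) = c - ln W - ln a"
      using a W by (simp add: ln_div ln_mult)
    moreover have "a * (exp c / W / a - 1) = exp c / W - a" using a by (simp add: right_diff_distrib)
    ultimately have "a * (c - ln W - ln a) \<le> exp c / W - a" by (simp only:)
    then show ?thesis by (simp add: right_diff_distrib)
  qed
  have "(\<integral>x. m x * s x - m x * ln W - m x * ln (m x) \<partial>M) \<le> (\<integral>x. exp (s x) / W - m x \<partial>M)"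
    using m s ml by (intro integral_mono int pointwise) auto
  also have "\<dots> = (\<integral>x. exp (s x) \<partial>M) / W - 1"
    using m s by (subst Bochner_Integration.integral_diff) (auto intro!: int)
  also have "\<dots> = 0" using W by (simp add: W_def)
  also have "(\<integral>x. m x * s x - m x * ln W - m x * ln (m x) \<partial>M)
      = (\<integral>x. m x * s x \<partial>M) - ln W - (\<integral>x. m x * ln (m x) \<partial>M)"
    using m s ml by (simp add: int bounded_borel_mult bounded_borel_diff)
  finally show ?thesis by (simp add: W_def)
qed

text \<open>The locale asks for a probability space at every index, not only in \<open>I\<close>;
  families built below are therefore padded outside \<open>I\<close>.\<close>

lemma finite_product_prob_spaceI:
  "finite I \<Longrightarrow> (\<And>i. prob_space (M i)) \<Longrightarrow> finite_product_prob_space M I"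
  by (auto simp: finite_product_prob_space_def product_prob_space_def finite_product_sigma_finite_def
      product_sigma_finite_def finite_product_sigma_finite_axioms_def product_prob_space_axioms_def
      intro: prob_space_imp_sigma_finite)

section \<open>Averaging coordinates of a product measure\<close>

context finite_product_prob_space
begin

abbreviation "P \<equiv> Pi\<^sub>M I M"

lemma space_P_override: "x \<in> space P \<Longrightarrow> z \<in> space P \<Longrightarrow> override_on x z J \<in> space P"
  by (auto simp: space_PiM override_on_def PiE_def extensional_def)

lemma space_P_upd: "x \<in> space P \<Longrightarrow> i \<in> I \<Longrightarrow> y \<in> space (M i) \<Longrightarrow> x(i := y) \<in> space P"
  by (auto simp: space_PiM PiE_def extensional_def)

lemma measurable_override [measurable]:
  "(\<lambda>(x, z). override_on x z J) \<in> measurable (P \<Otimes>\<^sub>M P) P"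
proof (rule measurable_PiM_single')
  fix i assume i: "i \<in> I"
  show "(\<lambda>\<omega>. (case \<omega> of (x, z) \<Rightarrow> override_on x z J) i) \<in> measurable (P \<Otimes>\<^sub>M P) (M i)"
  proof (cases "i \<in> J")
    case True
    then have "(\<lambda>\<omega>. (case \<omega> of (x, z) \<Rightarrow> override_on x z J) i) = (\<lambda>\<omega>. snd \<omega> i)"
      by (auto simp: fun_eq_iff split: prod.split)
    then show ?thesis by (rule ssubst) (use i in measurable)
  next
    case False
    then have "(\<lambda>\<omega>. (case \<omega> of (x, z) \<Rightarrow> override_on x z J) i) = (\<lambda>\<omega>. fst \<omega> i)"
      by (auto simp: fun_eq_iff split: prod.split)
    then show ?thesis by (rule ssubst) (use i in measurable)
  qed
next
  show "(\<lambda>(x, z). override_on x z J) \<in> space (P \<Otimes>\<^sub>M P) \<rightarrow> (\<Pi>\<^sub>E i\<in>I. space (M i))"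
    using space_P_override by (auto simp: space_pair_measure space_PiM[symmetric])
qed

lemma measurable_override_right:
  "x \<in> space P \<Longrightarrow> (\<lambda>z. override_on x z J) \<in> measurable P P"
  using measurable_compose[OF measurable_Pair1' measurable_override] by fastforce

sublocale PP: pair_prob_space P P ..

lemma sigma_finite_P: "sigma_finite_measure P"
  by unfold_locales

text \<open>Resampling the coordinates in \<open>J\<close> from an independent copy preserves the
  product measure. On a box this is visible directly: its preimage is a product of two boxes, and
  each side \<open>A i\<close> constrains exactly one of the two copies.\<close>

lemma distr_override: "distr (P \<Otimes>\<^sub>M P) P (\<lambda>(x, z). override_on x z J) = P"
proof (rule PiM_eqI)
  fix A assume A: "\<And>i. i \<in> I \<Longrightarrow> A i \<in> sets (M i)"
  let ?B = "\<lambda>i. if i \<in> J then space (M i) else A i"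
  let ?C = "\<lambda>i. if i \<in> J then A i else space (M i)"
  have sub: "A i \<subseteq> space (M i)" if "i \<in> I" for i using A[OF that] sets.sets_into_space by blast
  have "(\<lambda>(x, z). override_on x z J) -` Pi\<^sub>E I A \<inter> space (P \<Otimes>\<^sub>M P) = Pi\<^sub>E I ?B \<times> Pi\<^sub>E I ?C"
  proof (intro set_eqI iffI)
    fix \<omega> assume "\<omega> \<in> (\<lambda>(x, z). override_on x z J) -` Pi\<^sub>E I A \<inter> space (P \<Otimes>\<^sub>M P)"
    then obtain x z where \<omega>: "\<omega> = (x, z)" "override_on x z J \<in> Pi\<^sub>E I A" "x \<in> space P" "z \<in> space P"
      by (auto simp: space_pair_measure)
    have "x i \<in> ?B i" "z i \<in> ?C i" if "i \<in> I" for i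
      using \<omega> that PiE_mem[OF \<omega>(2) that] by (auto simp: space_PiM PiE_iff)
    then show "\<omega> \<in> Pi\<^sub>E I ?B \<times> Pi\<^sub>E I ?C" using \<omega> by (auto simp: space_PiM PiE_iff)
  next
    fix \<omega> assume "\<omega> \<in> Pi\<^sub>E I ?B \<times> Pi\<^sub>E I ?C"
    then obtain x z where \<omega>: "\<omega> = (x, z)" "x \<in> Pi\<^sub>E I ?B" "z \<in> Pi\<^sub>E I ?C" by blast
    have "override_on x z J i \<in> A i" if "i \<in> I" for i
      using PiE_mem[OF \<omega>(2) that] PiE_mem[OF \<omega>(3) that] by (auto simp: override_on_def)
    moreover have "x \<in> space P" "z \<in> space P" using \<omega> sub
      by (auto simp: space_PiM PiE_iff split: if_splits)
    moreover from this have "override_on x z J \<in> extensional I"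
      using space_P_override by (fastforce simp: space_PiM PiE_def)
    ultimately show "\<omega> \<in> (\<lambda>(x, z). override_on x z J) -` Pi\<^sub>E I A \<inter> space (P \<Otimes>\<^sub>M P)"
      by (auto simp: \<omega>(1) space_pair_measure PiE_iff)
  qed
  then have "emeasure (distr (P \<Otimes>\<^sub>M P) P (\<lambda>(x, z). override_on x z J)) (Pi\<^sub>E I A)
      = emeasure (P \<Otimes>\<^sub>M P) (Pi\<^sub>E I ?B \<times> Pi\<^sub>E I ?C)"
    using A by (subst emeasure_distr) (auto intro!: sets_PiM_I_finite finite_index)
  also have "\<dots> = emeasure P (Pi\<^sub>E I ?B) * emeasure P (Pi\<^sub>E I ?C)"
    using A finite_index by (intro sigma_finite_measure.emeasure_pair_measure_Times[OF sigma_finite_P] sets_PiM_I_finite) auto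
  also have "\<dots> = (\<Prod>i\<in>I. emeasure (M i) (?B i) * emeasure (M i) (?C i))"
    using A by (simp add: measure_times prod.distrib)
  also have "\<dots> = (\<Prod>i\<in>I. emeasure (M i) (A i))"
    by (intro prod.cong) (auto simp: M.emeasure_space_1)
  finally show "emeasure (distr (P \<Otimes>\<^sub>M P) P (\<lambda>(x, z). override_on x z J)) (Pi\<^sub>E I A)
      = (\<Prod>i\<in>I. emeasure (M i) (A i))" .
qed (use finite_index in auto)

text \<open>\<open>avg J\<close> is the conditional expectation given the coordinates outside \<open>J\<close>.\<close>

definition avg :: "'a set \<Rightarrow> (('a \<Rightarrow> 'b) \<Rightarrow> real) \<Rightarrow> ('a \<Rightarrow> 'b) \<Rightarrow> real" where
  "avg J g x = (\<integral>z. g (override_on x z J) \<partial>P)"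

lemma bounded_borel_override:
  assumes "bounded_borel P g" "x \<in> space P"
  shows "bounded_borel P (\<lambda>z. g (override_on x z J))"
  using bounded_borel_comp[OF assms(1) measurable_override_right[OF assms(2)]] .

lemma bounded_borel_pair_override:
  assumes "bounded_borel P g"
  shows "bounded_borel (P \<Otimes>\<^sub>M P) (\<lambda>(x, z). g (override_on x z J))"
  using bounded_borel_comp[OF assms measurable_override] by (simp add: case_prod_unfold)

lemma bounded_borel_avg [intro!]:
  assumes "bounded_borel P g"
  shows "bounded_borel P (avg J g)"
proof -
  obtain B where B: "\<And>x. x \<in> space P \<Longrightarrow> \<bar>g x\<bar> \<le> B" by (rule bounded_borelE[OF assms]) blast
  show ?thesis
  proof (rule bounded_borelI)
    show "avg J g \<in> borel_measurable P"
      unfolding avg_def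
      using bounded_borel_measurable[OF bounded_borel_pair_override[OF assms, of J]]
      by (intro sigma_finite_measure.borel_measurable_lebesgue_integral[OF sigma_finite_P]) auto
    fix x assume x: "x \<in> space P"
    have b: "- B \<le> g z" "g z \<le> B" if "z \<in> space P" for z using B[OF that] by auto
    have "- B \<le> avg J g x" "avg J g x \<le> B"
      unfolding avg_def
      by (intro P.integral_lower_bound P.integral_upper_bound b space_P_override[OF x]
          bounded_borel_override[OF assms x]; assumption)+
    then show "\<bar>avg J g x\<bar> \<le> B" by simp
  qed
qed

lemma integral_avg:
  assumes "bounded_borel P g"
  shows "(\<integral>x. avg J g x \<partial>P) = (\<integral>x. g x \<partial>P)"
proof -
  note [measurable] = bounded_borel_measurable[OF assms]
  have "(\<integral>x. avg J g x \<partial>P) = (\<integral>\<omega>. g (case \<omega> of (x, z) \<Rightarrow> override_on x z J) \<partial>(P \<Otimes>\<^sub>M P))"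
    unfolding avg_def
    using PP.integral_fst'[OF PP.P.bounded_borel_integrable[OF bounded_borel_pair_override[OF assms, of J]]]
    by (simp add: case_prod_unfold)
  also have "\<dots> = (\<integral>x. g x \<partial>distr (P \<Otimes>\<^sub>M P) P (\<lambda>(x, z). override_on x z J))"
    by (rule integral_distr[symmetric]) auto
  finally show ?thesis by (simp add: distr_override)
qed

text \<open>Two successive resamplings amount to one resampling of \<open>J \<union> K\<close> by
  the merged point \<open>override_on z w K\<close>, which again has law \<open>P\<close> by
  \<open>integral_avg\<close>.\<close>

lemma avg_avg:
  assumes "bounded_borel P g" "x \<in> space P"
  shows "avg J (avg K g) x = avg (J \<union> K) g x"
proof -
  have "avg J (avg K g) x = (\<integral>z. avg K (\<lambda>w. g (override_on x w (J \<union> K))) z \<partial>P)"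
    unfolding avg_def
    by (intro Bochner_Integration.integral_cong refl arg_cong[of _ _ g]) (auto simp: override_on_def fun_eq_iff)
  also have "\<dots> = avg (J \<union> K) g x"
    unfolding avg_def[of "J \<union> K"] using bounded_borel_override[OF assms] by (rule integral_avg)
  finally show ?thesis .
qed

lemma avg_empty [simp]: "avg {} g x = g x"
  by (simp add: avg_def P.prob_space)

lemma avg_UNIV: "I \<subseteq> J \<Longrightarrow> x \<in> space P \<Longrightarrow> avg J g x = (\<integral>z. g z \<partial>P)"
proof -
  assume *: "I \<subseteq> J" "x \<in> space P"
  have "override_on x z J = z" if "z \<in> space P" for z
  proof
    show "override_on x z J a = z a" for a
      using that * by (cases "a \<in> J"; cases "a \<in> I") (auto simp: space_PiM PiE_def extensional_def)
  qed
  then show ?thesis unfolding avg_def by (intro Bochner_Integration.integral_cong) auto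
qed

lemma avg_override: "avg J g (override_on x y J) = avg J g x"
  unfolding avg_def by (intro Bochner_Integration.integral_cong refl arg_cong[of _ _ g]) (auto simp: override_on_def)

lemma avg_lower:
  assumes "bounded_borel P g" "x \<in> space P" "\<And>z. z \<in> space P \<Longrightarrow> c \<le> g z"
  shows "c \<le> avg J g x"
  unfolding avg_def using assms bounded_borel_override space_P_override by (intro P.integral_lower_bound) auto

lemma avg_mult_left:
  assumes "\<And>z. z \<in> space P \<Longrightarrow> h (override_on x z J) = h x"
  shows "avg J (\<lambda>y. h y * g y) x = h x * avg J g x"
proof -
  have "avg J (\<lambda>y. h y * g y) x = (\<integral>z. h x * g (override_on x z J) \<partial>P)"
    unfolding avg_def using assms by (intro Bochner_Integration.integral_cong) auto
  then show ?thesis by (simp add: avg_def)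
qed

text \<open>The factor \<open>h\<close> is constant along the resampled coordinates and can be taken
  out of the conditional expectation.\<close>

lemma integral_mult_avg:
  assumes "bounded_borel P g" "bounded_borel P h"
    and "\<And>x z. x \<in> space P \<Longrightarrow> z \<in> space P \<Longrightarrow> h (override_on x z J) = h x"
  shows "(\<integral>x. h x * g x \<partial>P) = (\<integral>x. h x * avg J g x \<partial>P)"
proof -
  have "(\<integral>x. h x * g x \<partial>P) = (\<integral>x. avg J (\<lambda>x. h x * g x) x \<partial>P)"
    using assms by (intro integral_avg[symmetric]) auto
  also have "\<dots> = (\<integral>x. h x * avg J g x \<partial>P)"
    using assms by (intro Bochner_Integration.integral_cong refl avg_mult_left) auto
  finally show ?thesis .
qed

section \<open>Subadditivity of entropy for Gibbs measures\<close>

lemma avg_positive: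
  assumes "bounded_borel P f"
  obtains c where "0 < c" "\<And>J x. x \<in> space P \<Longrightarrow> c \<le> avg J (\<lambda>x. exp (f x)) x"
proof -
  obtain B where B: "\<And>x. x \<in> space P \<Longrightarrow> \<bar>f x\<bar> \<le> B" by (rule bounded_borelE[OF assms]) blast
  have "exp (- B) \<le> avg J (\<lambda>x. exp (f x)) x" if "x \<in> space P" for J x
    using assms that B by (intro avg_lower) (auto simp: abs_le_iff minus_le_iff)
  then show ?thesis using that[of "exp (- B)"] by simp
qed

lemma bounded_borel_ln_avg_exp [intro!]:
  assumes "bounded_borel P f"
  shows "bounded_borel P (\<lambda>x. ln (avg J (\<lambda>x. exp (f x)) x))"
proof -
  obtain c where "0 < c" "\<And>J x. x \<in> space P \<Longrightarrow> c \<le> avg J (\<lambda>x. exp (f x)) x"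
    by (rule avg_positive[OF assms]) blast
  then show ?thesis using assms by (intro bounded_borel_ln[of _ _ c]) auto
qed

lemma exp_ln_avg_exp:
  assumes "bounded_borel P f" "x \<in> space P"
  shows "exp (ln (avg J (\<lambda>x. exp (f x)) x)) = avg J (\<lambda>x. exp (f x)) x"
proof -
  obtain c where "0 < c" "\<And>J x. x \<in> space P \<Longrightarrow> c \<le> avg J (\<lambda>x. exp (f x)) x"
    by (rule avg_positive[OF assms(1)]) blast
  then show ?thesis using assms(2) by (metis exp_ln less_le_trans)
qed

text \<open>Han's inequality for the Gibbs measure with density proportional to \<open>exp f\<close>: up to the
  normalising constant, the left side is its relative entropy, and the \<open>i\<close>-th summand is the
  mean relative entropy of its conditional distribution of coordinate \<open>i\<close> given all the others.\<close>

lemma entropy_tensorization: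
  assumes f: "bounded_borel P f"
  shows "(\<integral>x. exp (f x) * (f x - ln (\<integral>x. exp (f x) \<partial>P)) \<partial>P)
     \<le> (\<Sum>i\<in>I. \<integral>x. exp (f x) * (f x - ln (avg {i} (\<lambda>x. exp (f x)) x)) \<partial>P)"
proof -
  define F where "F J x = ln (avg J (\<lambda>x. exp (f x)) x)" for J x
  have F: "bounded_borel P (F J)" for J
    unfolding F_def using f by auto
  have expF: "exp (F J x) = avg J (\<lambda>x. exp (f x)) x" if "x \<in> space P" for J x
    unfolding F_def by (rule exp_ln_avg_exp[OF f that])
  note int = P.bounded_borel_integrable
  \<comment> \<open>Conditioning on more coordinates can only raise the mean relative entropy of
    coordinate \<open>i\<close>. With \<open>h\<close> the difference of the two integrands,
    \<open>h \<le> exp h - 1\<close> reduces the claim to the fact that \<open>exp (f + h)\<close>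
    and \<open>exp f\<close> have the same integral.\<close>
  have step: "(\<integral>x. exp (f x) * (F J x - F (insert i J) x) \<partial>P) \<le> (\<integral>x. exp (f x) * (f x - F {i} x) \<partial>P)"
    for i J
  proof -
    define h where "h x = (F J x - F (insert i J) x) - (f x - F {i} x)" for x
    have h: "bounded_borel P h" unfolding h_def by (intro bounded_borel_diff f F)
    define w where "w x = exp (F {i} x - F (insert i J) x)" for x
    have w: "bounded_borel P w" unfolding w_def using F by auto
    have "(\<integral>x. exp (f x) * h x \<partial>P) \<le> (\<integral>x. exp (f x) * (exp (h x) - 1) \<partial>P)"
      using f h exp_ge_add_one_self
      by (intro integral_mono int mult_left_mono) (auto simp: algebra_simps)
    also have "\<dots> = (\<integral>x. exp (f x) * exp (h x) \<partial>P) - (\<integral>x. exp (f x) \<partial>P)"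
      using f h by (subst Bochner_Integration.integral_diff[symmetric]) (auto simp: algebra_simps intro!: int)
    also have "(\<integral>x. exp (f x) * exp (h x) \<partial>P) = (\<integral>x. w x * avg J (\<lambda>x. exp (f x)) x \<partial>P)"
      using expF
      by (intro Bochner_Integration.integral_cong) (auto simp: h_def w_def exp_add[symmetric] algebra_simps simp flip: expF)
    \<comment> \<open>The weight \<open>w\<close> does not involve coordinate \<open>i\<close>, so
      that coordinate can be averaged out of the other factor. This produces
      \<open>exp (F (insert i J))\<close>, which cancels against the denominator in
      \<open>w\<close>.\<close>
    also have "\<dots> = (\<integral>x. w x * avg {i} (avg J (\<lambda>x. exp (f x))) x \<partial>P)"
    proof (rule integral_mult_avg)
      fix x z assume "x \<in> space P" "z \<in> space P"
      have "avg (insert i J) g (override_on x z {i}) = avg (insert i J) g x" for g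
        unfolding avg_def by (intro Bochner_Integration.integral_cong refl arg_cong[of _ _ g]) (auto simp: override_on_def)
      then show "w (override_on x z {i}) = w x"
        by (simp add: w_def F_def avg_override)
    qed (use f w in auto)
    also have "\<dots> = (\<integral>x. avg {i} (\<lambda>x. exp (f x)) x \<partial>P)"
    proof (intro Bochner_Integration.integral_cong refl)
      fix x assume x: "x \<in> space P"
      have "avg {i} (avg J (\<lambda>x. exp (f x))) x = avg (insert i J) (\<lambda>x. exp (f x)) x"
        using avg_avg[of "\<lambda>x. exp (f x)" x "{i}" J] f x by auto
      then show "w x * avg {i} (avg J (\<lambda>x. exp (f x))) x = avg {i} (\<lambda>x. exp (f x)) x"
        using x by (simp add: w_def exp_add[symmetric] flip: expF)
    qed
    also have "\<dots> = (\<integral>x. exp (f x) \<partial>P)" using f by (intro integral_avg) auto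
    finally have "(\<integral>x. exp (f x) * h x \<partial>P) \<le> 0" by simp
    moreover have "(\<integral>x. exp (f x) * h x \<partial>P) =
        (\<integral>x. exp (f x) * (F J x - F (insert i J) x) \<partial>P) - (\<integral>x. exp (f x) * (f x - F {i} x) \<partial>P)"
      using f F by (subst Bochner_Integration.integral_diff[symmetric])
        (auto simp: h_def algebra_simps intro!: int)
    ultimately show ?thesis by simp
  qed
  \<comment> \<open>Adding coordinates one at a time telescopes from \<open>F {} = f\<close> to
    \<open>F I\<close>, the logarithm of the full integral.\<close>
  have "(\<integral>x. exp (f x) * (f x - F J x) \<partial>P) \<le> (\<Sum>i\<in>J. \<integral>x. exp (f x) * (f x - F {i} x) \<partial>P)"
    if "finite J" for J
    using that
  proof induction
    case empty
    show ?case by (simp add: F_def)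
  next
    case (insert i J)
    have "(\<integral>x. exp (f x) * (f x - F (insert i J) x) \<partial>P)
       = (\<integral>x. exp (f x) * (f x - F J x) \<partial>P) + (\<integral>x. exp (f x) * (F J x - F (insert i J) x) \<partial>P)"
      using f F by (subst Bochner_Integration.integral_add[symmetric])
        (auto simp: algebra_simps intro!: int)
    then show ?case using insert step[of J i] by simp
  qed
  from this[OF finite_index] have "(\<integral>x. exp (f x) * (f x - F I x) \<partial>P) \<le> (\<Sum>i\<in>I. \<integral>x. exp (f x) * (f x - F {i} x) \<partial>P)" .
  moreover have "(\<integral>x. exp (f x) * (f x - F I x) \<partial>P) = (\<integral>x. exp (f x) * (f x - ln (\<integral>x. exp (f x) \<partial>P)) \<partial>P)"
    by (intro Bochner_Integration.integral_cong) (auto simp: F_def avg_UNIV)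
  ultimately show ?thesis by (simp add: F_def)
qed

section \<open>Exponential moments under bounded differences\<close>

text \<open>Hoeffding's lemma for the function of coordinate \<open>i\<close> that remains when the
  other coordinates are frozen at those of \<open>x\<close>.\<close>

lemma avg_exp_le:
  assumes g: "bounded_borel P g" and x: "x \<in> space P" and t: "t > 0"
    and c: "\<And>z w. z \<in> space P \<Longrightarrow> w \<in> space P \<Longrightarrow> \<bar>g (override_on x z {i}) - g (override_on x w {i})\<bar> \<le> c"
  shows "avg {i} (\<lambda>x. exp (t * g x)) x \<le> exp (t * avg {i} g x + t\<^sup>2 * c\<^sup>2 / 8)"
proof -
  define G where "G z = g (override_on x z {i})" for z
  have G: "bounded_borel P G" unfolding G_def by (rule bounded_borel_override[OF g x])
  \<comment> \<open>With the infimum as left endpoint, the oscillation bound places all values in an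
    interval of length exactly \<open>c\<close>, as Hoeffding's lemma wants.\<close>
  define a where "a = Inf (G ` space P)"
  obtain B where B: "\<And>z. z \<in> space P \<Longrightarrow> \<bar>G z\<bar> \<le> B" by (rule bounded_borelE[OF G]) blast
  have bdd: "bdd_below (G ` space P)"
    using B by (intro bdd_belowI[of _ "- B"]) (force simp: abs_le_iff)
  have range: "G z \<in> {a..a + c}" if z: "z \<in> space P" for z
  proof -
    have "a \<le> G z" unfolding a_def using bdd z by (intro cInf_lower) auto
    moreover have "G z - c \<le> a"
      unfolding a_def
    proof (rule cInf_greatest)
      fix y assume "y \<in> G ` space P"
      then obtain w where "w \<in> space P" "y = G w" by blast
      then show "G z - c \<le> y" using c[OF z, of w] by (auto simp: G_def abs_le_iff)
    qed (use P.not_empty in simp)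
    ultimately show ?thesis by simp
  qed
  interpret H: interval_bounded_random_variable P G a "a + c"
    by unfold_locales (use range bounded_borel_measurable[OF G] in auto)
  let ?\<mu> = "\<integral>z. G z \<partial>P"
  have "(\<integral>\<^sup>+z. ennreal (exp (t * (G z - ?\<mu>))) \<partial>P) \<le> ennreal (exp (t\<^sup>2 * c\<^sup>2 / 8))"
    using H.Hoeffdings_lemma_nn_integral[OF t] by simp
  moreover have bb: "bounded_borel P (\<lambda>z. exp (t * (G z - ?\<mu>)))" using G by auto
  ultimately have "(\<integral>z. exp (t * (G z - ?\<mu>)) \<partial>P) \<le> exp (t\<^sup>2 * c\<^sup>2 / 8)"
    by (simp add: nn_integral_eq_integral P.bounded_borel_integrable)
  then have "exp (t * ?\<mu>) * (\<integral>z. exp (t * (G z - ?\<mu>)) \<partial>P) \<le> exp (t * ?\<mu>) * exp (t\<^sup>2 * c\<^sup>2 / 8)"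
    by (intro mult_left_mono) auto
  moreover have "exp (t * ?\<mu>) * (\<integral>z. exp (t * (G z - ?\<mu>)) \<partial>P) = (\<integral>z. exp (t * G z) \<partial>P)"
    by (subst integral_mult_right_zero[symmetric]) (auto simp: exp_add[symmetric] algebra_simps)
  ultimately have "(\<integral>z. exp (t * G z) \<partial>P) \<le> exp (t * ?\<mu>) * exp (t\<^sup>2 * c\<^sup>2 / 8)" by linarith
  then show ?thesis by (simp add: avg_def G_def exp_add)
qed

text \<open>McDiarmid's argument: coordinates are averaged out one by one. Each costs a factor
  \<open>exp (t^2 * (c i)^2 / 8)\<close>, and after the last one \<open>g\<close> has become its
  mean.\<close>

lemma integral_exp_bounded_differences:
  assumes g: "bounded_borel P g" and t: "t > 0"
    and c: "\<And>i x z. i \<in> I \<Longrightarrow> x \<in> space P \<Longrightarrow> z \<in> space P \<Longrightarrow> \<bar>g x - g (override_on x z {i})\<bar> \<le> c i"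
  shows "(\<integral>x. exp (t * g x) \<partial>P) \<le> exp (t * (\<integral>x. g x \<partial>P) + t\<^sup>2 * (\<Sum>i\<in>I. (c i)\<^sup>2) / 8)"
proof -
  note int = P.bounded_borel_integrable
  \<comment> \<open>Averaging over \<open>J\<close> does not increase the oscillation in a
    coordinate outside \<open>J\<close>, since the two resamplings commute.\<close>
  have osc: "\<bar>avg J g x - avg J g (override_on x z {i})\<bar> \<le> c i"
    if i: "i \<in> I" "i \<notin> J" and x: "x \<in> space P" and z: "z \<in> space P" for i J x z
  proof -
    have sw: "override_on (override_on x z {i}) w J = override_on (override_on x w J) z {i}" for w
      using i by (auto simp: override_on_def fun_eq_iff)
    have xz: "override_on x z {i} \<in> space P" using x z by (rule space_P_override)
    have "avg J g x - avg J g (override_on x z {i})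
        = (\<integral>w. g (override_on x w J) - g (override_on (override_on x w J) z {i}) \<partial>P)"
      unfolding avg_def using bounded_borel_override[OF g x, of J] bounded_borel_override[OF g xz, of J]
      by (subst Bochner_Integration.integral_diff) (auto simp: sw int)
    moreover have bb: "bounded_borel P (\<lambda>w. g (override_on x w J) - g (override_on (override_on x w J) z {i}))"
      using bounded_borel_override[OF g x, of J] bounded_borel_override[OF g xz, of J]
      by (auto simp: sw)
    moreover have d: "\<bar>g (override_on x w J) - g (override_on (override_on x w J) z {i})\<bar> \<le> c i" if "w \<in> space P" for w
      using c[OF i(1) space_P_override[OF x that] z] .
    ultimately show ?thesis
      using P.integral_lower_bound[OF bb, of "- c i"] P.integral_upper_bound[OF bb, of "c i"]
      by (force simp: abs_le_iff)
  qed
  have "(\<integral>x. exp (t * g x) \<partial>P) \<le> exp (t\<^sup>2 * (\<Sum>i\<in>J. (c i)\<^sup>2) / 8) * (\<integral>x. exp (t * avg J g x) \<partial>P)"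
    if "finite J" "J \<subseteq> I" for J
    using that
  proof induction
    case empty
    show ?case by simp
  next
    case (insert i J)
    let ?G = "avg J g"
    have G: "bounded_borel P ?G" using g by auto
    have "(\<integral>x. exp (t * ?G x) \<partial>P) = (\<integral>x. avg {i} (\<lambda>x. exp (t * ?G x)) x \<partial>P)"
      using G by (intro integral_avg[symmetric]) auto
    also have "\<dots> \<le> (\<integral>x. exp (t\<^sup>2 * (c i)\<^sup>2 / 8) * exp (t * avg (insert i J) g x) \<partial>P)"
    proof (intro integral_mono int)
      fix x assume x: "x \<in> space P"
      have "avg {i} (\<lambda>x. exp (t * ?G x)) x \<le> exp (t * avg {i} ?G x + t\<^sup>2 * (c i)\<^sup>2 / 8)"
      proof (rule avg_exp_le[OF G x t])
        fix z w assume z: "z \<in> space P" and w: "w \<in> space P"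
        have "override_on (override_on x z {i}) w {i} = override_on x w {i}"
          by (auto simp: override_on_def fun_eq_iff)
        then show "\<bar>?G (override_on x z {i}) - ?G (override_on x w {i})\<bar> \<le> c i"
          using osc[of i J "override_on x z {i}" w] insert.hyps insert.prems space_P_override[OF x z] w by auto
      qed
      then show "avg {i} (\<lambda>x. exp (t * ?G x)) x \<le> exp (t\<^sup>2 * (c i)\<^sup>2 / 8) * exp (t * avg (insert i J) g x)"
        using avg_avg[OF g x, of "{i}" J] by (simp add: exp_add mult.commute)
    qed (intro bounded_borel_avg bounded_borel_exp bounded_borel_cmult g)+
    finally have "(\<integral>x. exp (t * ?G x) \<partial>P) \<le> exp (t\<^sup>2 * (c i)\<^sup>2 / 8) * (\<integral>x. exp (t * avg (insert i J) g x) \<partial>P)"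
      by simp
    then have "exp (t\<^sup>2 * (\<Sum>i\<in>J. (c i)\<^sup>2) / 8) * (\<integral>x. exp (t * ?G x) \<partial>P)
       \<le> exp (t\<^sup>2 * (\<Sum>i\<in>J. (c i)\<^sup>2) / 8) * (exp (t\<^sup>2 * (c i)\<^sup>2 / 8) * (\<integral>x. exp (t * avg (insert i J) g x) \<partial>P))"
      by (intro mult_left_mono) auto
    also have "\<dots> = exp (t\<^sup>2 * (\<Sum>i\<in>insert i J. (c i)\<^sup>2) / 8) * (\<integral>x. exp (t * avg (insert i J) g x) \<partial>P)"
      using insert.hyps by (simp add: exp_add algebra_simps add_divide_distrib)
    finally show ?case using insert by simp
  qed
  from this[OF finite_index subset_refl]
  have "(\<integral>x. exp (t * g x) \<partial>P) \<le> exp (t\<^sup>2 * (\<Sum>i\<in>I. (c i)\<^sup>2) / 8) * (\<integral>x. exp (t * avg I g x) \<partial>P)" .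
  moreover have "(\<integral>x. exp (t * avg I g x) \<partial>P) = (\<integral>x. exp (t * (\<integral>x. g x \<partial>P)) \<partial>P)"
    by (intro Bochner_Integration.integral_cong) (auto simp: avg_UNIV)
  ultimately show ?thesis by (simp add: P.prob_space exp_add mult.commute)
qed

section \<open>Approximation by product measures\<close>

lemma bounded_borel_component:
  "i \<in> I \<Longrightarrow> bounded_borel (M i) g \<Longrightarrow> bounded_borel P (\<lambda>x. g (x i))"
  by (erule bounded_borel_comp) auto

text \<open>On a box both the density and the indicator factor over the coordinates, so the integral
  is a product of one-dimensional integrals; boxes determine the measure.\<close>

lemma product_density:
  assumes \<rho>: "\<And>i. i \<in> I \<Longrightarrow> bounded_borel (M i) (\<rho> i)"
    "\<And>i y. i \<in> I \<Longrightarrow> y \<in> space (M i) \<Longrightarrow> 0 \<le> \<rho> i y"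
    and int1: "\<And>i. i \<in> I \<Longrightarrow> (\<integral>y. \<rho> i y \<partial>M i) = 1"
    and \<nu>_def: "\<nu> = (\<lambda>i. if i \<in> I then density (M i) (\<rho> i) else M i)"
  shows "finite_product_prob_space \<nu> I" "Pi\<^sub>M I \<nu> = density P (\<lambda>x. ennreal (\<Prod>i\<in>I. \<rho> i (x i)))"
proof -
  have m[measurable]: "\<rho> i \<in> borel_measurable (M i)" if "i \<in> I" for i
    using bounded_borel_measurable[OF \<rho>(1)[OF that]] .
  have "prob_space (\<nu> i)" for i
  proof (cases "i \<in> I")
    case True
    have "emeasure (density (M i) (\<rho> i)) (space (M i)) = (\<integral>\<^sup>+y. ennreal (\<rho> i y) \<partial>M i)"
      using m[OF True] by (subst emeasure_density) (auto intro!: nn_integral_cong)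
    also have "\<dots> = 1"
      using True \<rho> int1 by (subst nn_integral_eq_integral) (auto intro!: M.bounded_borel_integrable)
    finally show ?thesis using True by (intro prob_spaceI) (simp add: \<nu>_def)
  qed (simp add: \<nu>_def M.prob_space_axioms)
  then show fin: "finite_product_prob_space \<nu> I"
    using finite_index by (intro finite_product_prob_spaceI)
  interpret N: finite_product_prob_space \<nu> I by (rule fin)
  let ?D = "density P (\<lambda>x. ennreal (\<Prod>i\<in>I. \<rho> i (x i)))"
  have sets: "sets (\<nu> i) = sets (M i)" for i by (simp add: \<nu>_def)
  have "?D = Pi\<^sub>M I \<nu>"
  proof (rule N.PiM_eqI)
    show "sets ?D = sets (Pi\<^sub>M I \<nu>)" by (simp add: sets cong: sets_PiM_cong)
    fix A assume "\<And>i. i \<in> I \<Longrightarrow> A i \<in> sets (\<nu> i)"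
    then have A: "A i \<in> sets (M i)" if "i \<in> I" for i using that sets by blast
    have ind: "indicator (Pi\<^sub>E I A) x = (\<Prod>i\<in>I. indicator (A i) (x i) :: ennreal)"
      if "x \<in> space P" for x
      using that finite_index
      by (auto simp: indicator_def space_PiM PiE_iff intro!: prod.neutral)
    have "emeasure ?D (Pi\<^sub>E I A) = (\<integral>\<^sup>+x. ennreal (\<Prod>i\<in>I. \<rho> i (x i)) * indicator (Pi\<^sub>E I A) x \<partial>P)"
      using A finite_index by (intro emeasure_density) (auto intro!: sets_PiM_I_finite)
    also have "\<dots> = (\<integral>\<^sup>+x. (\<Prod>i\<in>I. ennreal (\<rho> i (x i)) * indicator (A i) (x i)) \<partial>P)"
    proof (intro nn_integral_cong)
      fix x assume x: "x \<in> space P"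
      have "ennreal (\<Prod>i\<in>I. \<rho> i (x i)) = (\<Prod>i\<in>I. ennreal (\<rho> i (x i)))"
        using \<rho>(2) x by (intro prod_ennreal[symmetric]) (auto simp: space_PiM)
      then show "ennreal (\<Prod>i\<in>I. \<rho> i (x i)) * indicator (Pi\<^sub>E I A) x
          = (\<Prod>i\<in>I. ennreal (\<rho> i (x i)) * indicator (A i) (x i))"
        by (simp add: ind[OF x] prod.distrib)
    qed
    also have "\<dots> = (\<Prod>i\<in>I. \<integral>\<^sup>+y. ennreal (\<rho> i y) * indicator (A i) y \<partial>M i)"
      using finite_index A m by (intro product_nn_integral_prod) (auto intro!: borel_measurable_times_ennreal)
    also have "\<dots> = (\<Prod>i\<in>I. emeasure (\<nu> i) (A i))"
      using A m by (intro prod.cong refl) (auto simp: \<nu>_def emeasure_density)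
    finally show "emeasure ?D (Pi\<^sub>E I A) = (\<Prod>i\<in>I. emeasure (\<nu> i) (A i))" .
  qed (rule finite_index)
  then show "Pi\<^sub>M I \<nu> = ?D" by simp
qed

lemma integral_component:
  assumes "i \<in> I" "bounded_borel (M i) g"
  shows "(\<integral>x. g (x i) \<partial>P) = (\<integral>y. g y \<partial>M i)"
proof -
  note [measurable] = bounded_borel_measurable[OF assms(2)]
  have "(\<integral>x. g (x i) \<partial>P) = (\<integral>y. g y \<partial>distr P (M i) (\<lambda>x. x i))"
    using assms(1) by (subst integral_distr) auto
  then show ?thesis by (simp add: PiM_component[OF assms(1)])
qed

text \<open>The logarithm turns the product into a sum. In the \<open>i\<close>-th summand all
  factors but one are plain densities, which integrate to 1.\<close>

lemma entropy_product_density: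
  assumes \<rho>: "\<And>i. i \<in> I \<Longrightarrow> bounded_borel (M i) (\<rho> i)"
    "\<And>i y. i \<in> I \<Longrightarrow> y \<in> space (M i) \<Longrightarrow> 0 \<le> \<rho> i y"
    and int1: "\<And>i. i \<in> I \<Longrightarrow> (\<integral>y. \<rho> i y \<partial>M i) = 1"
  shows "(\<integral>x. (\<Prod>i\<in>I. \<rho> i (x i)) * ln (\<Prod>i\<in>I. \<rho> i (x i)) \<partial>P)
    = (\<Sum>i\<in>I. \<integral>y. \<rho> i y * ln (\<rho> i y) \<partial>M i)"
proof -
  define \<phi> where "\<phi> i j = (if j = i then \<lambda>y. \<rho> i y * ln (\<rho> i y) else \<rho> j)" for i j
  have \<phi>: "bounded_borel (M j) (\<phi> i j)" if "j \<in> I" for i j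
    using bounded_borel_mult_ln[OF \<rho>(1)[OF that] \<rho>(2)[OF that]] \<rho>(1)[OF that]
    by (cases "j = i") (simp_all add: \<phi>_def)
  have \<phi>_prod: "(\<Prod>j\<in>I. \<phi> i j (x j)) = (\<Prod>j\<in>I. \<rho> j (x j)) * ln (\<rho> i (x i))" if "i \<in> I" for i x
  proof -
    have "(\<Prod>j\<in>I. \<phi> i j (x j)) = (\<Prod>j\<in>I. \<rho> j (x j) * (if j = i then ln (\<rho> i (x i)) else 1))"
      by (intro prod.cong) (auto simp: \<phi>_def)
    also have "\<dots> = (\<Prod>j\<in>I. \<rho> j (x j)) * ln (\<rho> i (x i))"
      using that finite_index by (simp add: prod.distrib)
    finally show ?thesis .
  qed
  have "(\<integral>x. (\<Prod>i\<in>I. \<rho> i (x i)) * ln (\<Prod>i\<in>I. \<rho> i (x i)) \<partial>P) = (\<integral>x. (\<Sum>i\<in>I. \<Prod>j\<in>I. \<phi> i j (x j)) \<partial>P)"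
  proof (intro Bochner_Integration.integral_cong refl)
    fix x assume x: "x \<in> space P"
    then have nn: "0 \<le> \<rho> i (x i)" if "i \<in> I" for i using that \<rho>(2) by (auto simp: space_PiM)
    show "(\<Prod>i\<in>I. \<rho> i (x i)) * ln (\<Prod>i\<in>I. \<rho> i (x i)) = (\<Sum>i\<in>I. \<Prod>j\<in>I. \<phi> i j (x j))"
    \<comment> \<open>The logarithm of a product splits only over positive factors; if one factor
      vanishes, both sides are 0.\<close>
    proof (cases "\<exists>i\<in>I. \<rho> i (x i) = 0")
      case True
      then have "(\<Prod>i\<in>I. \<rho> i (x i)) = 0" using finite_index by auto
      then show ?thesis by (simp add: \<phi>_prod)
    next
      case False
      then have "ln (\<Prod>i\<in>I. \<rho> i (x i)) = (\<Sum>i\<in>I. ln (\<rho> i (x i)))"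
        using nn finite_index by (intro ln_prod) (auto simp: less_le)
      then show ?thesis by (simp add: \<phi>_prod sum_distrib_left)
    qed
  qed
  also have "\<dots> = (\<Sum>i\<in>I. \<integral>x. (\<Prod>j\<in>I. \<phi> i j (x j)) \<partial>P)"
    using \<phi> by (intro Bochner_Integration.integral_sum P.bounded_borel_integrable bounded_borel_prod bounded_borel_component)
  also have "\<dots> = (\<Sum>i\<in>I. \<integral>y. \<rho> i y * ln (\<rho> i y) \<partial>M i)"
  proof (intro sum.cong refl)
    fix i assume i: "i \<in> I"
    have "(\<integral>x. (\<Prod>j\<in>I. \<phi> i j (x j)) \<partial>P) = (\<Prod>j\<in>I. integral\<^sup>L (M j) (\<phi> i j))"
      using \<phi> finite_index by (intro product_integral_prod M.bounded_borel_integrable)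
    also have "\<dots> = (\<Prod>j\<in>I. if j = i then (\<integral>y. \<rho> i y * ln (\<rho> i y) \<partial>M i) else 1)"
      using int1 by (intro prod.cong) (auto simp: \<phi>_def)
    also have "\<dots> = (\<integral>y. \<rho> i y * ln (\<rho> i y) \<partial>M i)" using i finite_index by simp
    finally show "(\<integral>x. (\<Prod>j\<in>I. \<phi> i j (x j)) \<partial>P) = (\<integral>y. \<rho> i y * ln (\<rho> i y) \<partial>M i)" .
  qed
  finally show ?thesis .
qed

text \<open>\<open>avg (I - {i}) m x\<close> depends only on \<open>x i\<close>, so the choice of the point does not matter.\<close>

definition marginal_density :: "(('a \<Rightarrow> 'b) \<Rightarrow> real) \<Rightarrow> 'a \<Rightarrow> 'b \<Rightarrow> real" where
  "marginal_density m i y = avg (I - {i}) m ((SOME x. x \<in> space P)(i := y))"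

lemma some_in_space_P: "(SOME x. x \<in> space P) \<in> space P"
  using P.not_empty by (simp add: some_in_eq)

lemma marginal_density_component:
  assumes "i \<in> I" "x \<in> space P"
  shows "marginal_density m i (x i) = avg (I - {i}) m x"
proof -
  have "override_on ((SOME x. x \<in> space P)(i := x i)) z (I - {i}) a = override_on x z (I - {i}) a" for z a
  proof (cases "a \<in> I")
    case False
    then have "y a = undefined" if "y \<in> space P" for y
      using that by (auto simp: space_PiM PiE_def extensional_def)
    from this[OF some_in_space_P] this[OF assms(2)] show ?thesis
      using False assms(1) by (auto simp: override_on_def)
  qed (auto simp: override_on_def)
  then have "override_on ((SOME x. x \<in> space P)(i := x i)) z (I - {i}) = override_on x z (I - {i})" for z
    by blast
  then show ?thesis by (simp add: marginal_density_def avg_def)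
qed

lemma measurable_fun_upd_component:
  assumes "i \<in> I" "x \<in> space P"
  shows "(\<lambda>y. x(i := y)) \<in> measurable (M i) P"
proof -
  have I: "I = I \<union> {i}" using assms(1) by blast
  show ?thesis by (rule measurable_fun_upd[OF I]) (use assms(2) in auto)
qed

lemma bounded_borel_marginal_density:
  assumes "bounded_borel P m" "i \<in> I"
  shows "bounded_borel (M i) (marginal_density m i)"
  unfolding marginal_density_def
  using bounded_borel_comp[OF bounded_borel_avg[OF assms(1)] measurable_fun_upd_component[OF assms(2) some_in_space_P]] .

lemma marginal_density_nonneg:
  assumes "bounded_borel P m" "\<And>x. x \<in> space P \<Longrightarrow> 0 \<le> m x" "i \<in> I" "y \<in> space (M i)"
  shows "0 \<le> marginal_density m i y"
  unfolding marginal_density_def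
  using assms space_P_upd[OF some_in_space_P] by (intro avg_lower) auto

text \<open>A function of \<open>x i\<close> alone is unaffected by resampling the other
  coordinates, so \<open>m\<close> may be replaced by its average over them.\<close>

lemma integral_marginal_density:
  assumes m: "bounded_borel P m" and i: "i \<in> I" and g: "bounded_borel (M i) g"
  shows "(\<integral>x. m x * g (x i) \<partial>P) = (\<integral>y. marginal_density m i y * g y \<partial>M i)"
proof -
  have "(\<integral>x. g (x i) * m x \<partial>P) = (\<integral>x. g (x i) * avg (I - {i}) m x \<partial>P)"
    using m i g by (intro integral_mult_avg bounded_borel_component) auto
  also have "\<dots> = (\<integral>x. marginal_density m i (x i) * g (x i) \<partial>P)"
    by (intro Bochner_Integration.integral_cong refl) (simp add: marginal_density_component[OF i])
  also have "\<dots> = (\<integral>y. marginal_density m i y * g y \<partial>M i)"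
    using integral_component[OF i, of "\<lambda>y. marginal_density m i y * g y"]
      bounded_borel_marginal_density[OF m i] g by auto
  finally show ?thesis by (simp add: mult.commute)
qed

text \<open>The logarithm of a marginal density may be unbounded below, so Donsker--Varadhan is applied
  to the shifted densities \<open>\<rho> i + 1 / Suc k\<close>, and then \<open>k \<rightarrow> \<infinity>\<close>.\<close>

lemma donsker_varadhan_product:
  assumes m: "bounded_borel P m" "\<And>x. x \<in> space P \<Longrightarrow> 0 \<le> m x" "(\<integral>x. m x \<partial>P) = 1"
    and s: "bounded_borel P s"
  defines "\<rho> \<equiv> marginal_density m"
  assumes pos: "(\<integral>x. exp (s x) * (\<Prod>i\<in>I. \<rho> i (x i)) \<partial>P) > 0"
  shows "(\<integral>x. m x * s x \<partial>P) + (\<Sum>i\<in>I. \<integral>y. \<rho> i y * ln (\<rho> i y) \<partial>M i) - (\<integral>x. m x * ln (m x) \<partial>P)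
     \<le> ln (\<integral>x. exp (s x) * (\<Prod>i\<in>I. \<rho> i (x i)) \<partial>P)"
proof -
  have \<rho>: "bounded_borel (M i) (\<rho> i)" "\<And>y. y \<in> space (M i) \<Longrightarrow> 0 \<le> \<rho> i y" if "i \<in> I" for i
    using bounded_borel_marginal_density[OF m(1) that] marginal_density_nonneg[OF m(1,2) that]
    by (auto simp: \<rho>_def)
  \<comment> \<open>The shift \<open>1 / Suc k\<close> is positive for every \<open>k\<close> and
    largest at \<open>k = 0\<close>, which makes \<open>Q 0\<close> the dominating function for the
    limit.\<close>
  define Q where "Q k x = exp (s x) * (\<Prod>i\<in>I. \<rho> i (x i) + 1 / real (Suc k))" for k :: nat and x
  have Q: "bounded_borel P (Q k)" for k
    unfolding Q_def using s \<rho> by (auto intro!: bounded_borel_component)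
  let ?lhs = "(\<integral>x. m x * s x \<partial>P) + (\<Sum>i\<in>I. \<integral>y. \<rho> i y * ln (\<rho> i y) \<partial>M i) - (\<integral>x. m x * ln (m x) \<partial>P)"
  have "?lhs \<le> ln (\<integral>x. Q k x \<partial>P)" for k
  proof -
    define \<eta> where "\<eta> = 1 / real (Suc k)"
    have \<eta>: "\<eta> > 0" by (simp add: \<eta>_def)
    have ln\<rho>: "bounded_borel (M i) (\<lambda>y. ln (\<rho> i y + \<eta>))" if "i \<in> I" for i
      using \<rho>[OF that] \<eta> by (intro bounded_borel_ln[of _ _ \<eta>]) auto
    \<comment> \<open>The test function is chosen so that \<open>exp s'\<close> is the shifted
      integrand \<open>Q k\<close>.\<close>
    define s' where "s' x = s x + (\<Sum>i\<in>I. ln (\<rho> i (x i) + \<eta>))" for x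
    have s': "bounded_borel P s'"
      unfolding s'_def using s ln\<rho> bounded_borel_component by auto
    have "(\<Sum>i\<in>I. \<integral>y. \<rho> i y * ln (\<rho> i y) \<partial>M i) \<le> (\<Sum>i\<in>I. \<integral>x. m x * ln (\<rho> i (x i) + \<eta>) \<partial>P)"
    proof (rule sum_mono)
      fix i assume i: "i \<in> I"
      have "(\<integral>y. \<rho> i y * ln (\<rho> i y) \<partial>M i) \<le> (\<integral>y. \<rho> i y * ln (\<rho> i y + \<eta>) \<partial>M i)"
      proof (intro integral_mono M.bounded_borel_integrable bounded_borel_mult_ln bounded_borel_mult \<rho> ln\<rho> i)
        fix y assume "y \<in> space (M i)"
        then have "0 \<le> \<rho> i y" using \<rho>(2)[OF i] by blast
        then show "\<rho> i y * ln (\<rho> i y) \<le> \<rho> i y * ln (\<rho> i y + \<eta>)"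
          using \<eta> by (cases "\<rho> i y = 0") auto
      qed
      then show "(\<integral>y. \<rho> i y * ln (\<rho> i y) \<partial>M i) \<le> (\<integral>x. m x * ln (\<rho> i (x i) + \<eta>) \<partial>P)"
        using integral_marginal_density[OF m(1) i ln\<rho>[OF i]] by (simp add: \<rho>_def)
    qed
    moreover have "(\<integral>x. m x * s' x \<partial>P)
        = (\<integral>x. m x * s x \<partial>P) + (\<Sum>i\<in>I. \<integral>x. m x * ln (\<rho> i (x i) + \<eta>) \<partial>P)"
    proof -
      have b: "bounded_borel P (\<lambda>x. m x * ln (\<rho> i (x i) + \<eta>))" if "i \<in> I" for i
        by (intro bounded_borel_mult m bounded_borel_component[OF that ln\<rho>[OF that]])
      have "(\<integral>x. m x * s' x \<partial>P) = (\<integral>x. m x * s x + (\<Sum>i\<in>I. m x * ln (\<rho> i (x i) + \<eta>)) \<partial>P)"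
        by (simp add: s'_def distrib_left sum_distrib_left)
      also have "\<dots> = (\<integral>x. m x * s x \<partial>P) + (\<integral>x. (\<Sum>i\<in>I. m x * ln (\<rho> i (x i) + \<eta>)) \<partial>P)"
        by (intro Bochner_Integration.integral_add P.bounded_borel_integrable bounded_borel_sum
            bounded_borel_mult[OF m(1) s] b)
      also have "(\<integral>x. (\<Sum>i\<in>I. m x * ln (\<rho> i (x i) + \<eta>)) \<partial>P) = (\<Sum>i\<in>I. \<integral>x. m x * ln (\<rho> i (x i) + \<eta>) \<partial>P)"
        using b by (intro Bochner_Integration.integral_sum P.bounded_borel_integrable)
      finally show ?thesis .
    qed
    ultimately have "?lhs \<le> (\<integral>x. m x * s' x \<partial>P) - (\<integral>x. m x * ln (m x) \<partial>P)" by simp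
    also have "\<dots> \<le> ln (\<integral>x. exp (s' x) \<partial>P)" by (rule P.donsker_varadhan[OF m s'])
    also have "(\<integral>x. exp (s' x) \<partial>P) = (\<integral>x. Q k x \<partial>P)"
    proof (intro Bochner_Integration.integral_cong refl)
      fix x assume "x \<in> space P"
      then have "\<rho> i (x i) + \<eta> > 0" if "i \<in> I" for i
        using \<rho>(2)[OF that] that \<eta> by (auto simp: space_PiM intro!: add_nonneg_pos)
      then show "exp (s' x) = Q k x"
        using finite_index by (simp add: s'_def Q_def exp_add exp_sum \<eta>_def)
    qed
    finally show ?thesis .
  qed
  \<comment> \<open>Dominated convergence gives the limit of the integrals; \<open>pos\<close> keeps
    that limit away from 0, where \<open>ln\<close> is not continuous.\<close>
  moreover have "(\<lambda>k. ln (\<integral>x. Q k x \<partial>P)) \<longlonglongrightarrow> ln (\<integral>x. exp (s x) * (\<Prod>i\<in>I. \<rho> i (x i)) \<partial>P)"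
  proof (intro tendsto_ln)
    show "(\<lambda>k. \<integral>x. Q k x \<partial>P) \<longlonglongrightarrow> (\<integral>x. exp (s x) * (\<Prod>i\<in>I. \<rho> i (x i)) \<partial>P)"
    proof (rule integral_dominated_convergence)
      show "(\<lambda>x. exp (s x) * (\<Prod>i\<in>I. \<rho> i (x i))) \<in> borel_measurable P"
        using s \<rho> by (intro bounded_borel_measurable) (auto intro!: bounded_borel_component)
      show "Q k \<in> borel_measurable P" for k using bounded_borel_measurable[OF Q] .
      show "integrable P (Q 0)" using P.bounded_borel_integrable[OF Q] .
      show "AE x in P. (\<lambda>k. Q k x) \<longlonglongrightarrow> exp (s x) * (\<Prod>i\<in>I. \<rho> i (x i))"
        unfolding Q_def
        by (intro AE_I2 tendsto_mult tendsto_const tendsto_prod)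
          (use tendsto_add[OF tendsto_const LIMSEQ_Suc[OF lim_1_over_n]] in fastforce)
      show "AE x in P. norm (Q k x) \<le> Q 0 x" for k
      proof (intro AE_I2)
        fix x assume "x \<in> space P"
        then have nn: "\<rho> i (x i) \<ge> 0" if "i \<in> I" for i
          using \<rho>(2)[OF that] that by (auto simp: space_PiM)
        have "(\<Prod>i\<in>I. \<rho> i (x i) + 1 / real (Suc k)) \<le> (\<Prod>i\<in>I. \<rho> i (x i) + 1 / real (Suc 0))"
          using nn by (intro prod_mono) auto
        moreover have "0 \<le> (\<Prod>i\<in>I. \<rho> i (x i) + 1 / real (Suc k))"
          using nn by (intro prod_nonneg) auto
        ultimately show "norm (Q k x) \<le> Q 0 x"
          unfolding Q_def by (simp add: abs_mult)
      qed
    qed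
  qed (use pos in simp)
  ultimately show ?thesis by (intro LIMSEQ_le_const) auto
qed

text \<open>The product measure is the product of the marginals of \<open>m\<close>, which minimises the relative
  entropy of \<open>m\<close> among all product measures.\<close>

lemma product_approximation:
  assumes m: "bounded_borel P m" "\<And>x. x \<in> space P \<Longrightarrow> 0 \<le> m x" "(\<integral>x. m x \<partial>P) = 1"
    and f: "bounded_borel P f" and t: "t > 0"
    and c: "\<And>i x z. i \<in> I \<Longrightarrow> x \<in> space P \<Longrightarrow> z \<in> space P \<Longrightarrow> \<bar>f x - f (override_on x z {i})\<bar> \<le> c i"
    and u: "\<And>i. i \<in> I \<Longrightarrow> bounded_borel (M i) (u i)"
    and u1: "\<And>i. i \<in> I \<Longrightarrow> (\<integral>y. exp (u i y) \<partial>M i) \<le> 1"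
  obtains \<nu> \<kappa> where "\<And>i. i \<in> I \<Longrightarrow> prob_space (\<nu> i)" "\<And>i. i \<in> I \<Longrightarrow> sets (\<nu> i) = sets (M i)"
    and "kl_div (Pi\<^sub>M I \<nu>) P = ereal \<kappa>"
    and "(\<integral>x. m x * f x \<partial>P) - (\<integral>x. m x * ln (m x) \<partial>P) \<le> (\<integral>x. f x \<partial>Pi\<^sub>M I \<nu>) - \<kappa>
      + ((\<integral>x. m x * ln (m x) \<partial>P) - (\<Sum>i\<in>I. \<integral>x. m x * u i (x i) \<partial>P)) / t + t * (\<Sum>i\<in>I. (c i)\<^sup>2) / 8"
proof -
  define \<rho> where "\<rho> = marginal_density m"
  have \<rho>: "bounded_borel (M i) (\<rho> i)" "\<And>y. y \<in> space (M i) \<Longrightarrow> 0 \<le> \<rho> i y"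
    "(\<integral>y. \<rho> i y \<partial>M i) = 1" if "i \<in> I" for i
    using bounded_borel_marginal_density[OF m(1) that] marginal_density_nonneg[OF m(1,2) that]
      integral_marginal_density[OF m(1) that, of "\<lambda>_. 1"] m(3)
    by (auto simp: \<rho>_def)
  define \<nu> where "\<nu> = (\<lambda>i. if i \<in> I then density (M i) (\<rho> i) else M i)"
  interpret N: finite_product_prob_space \<nu> I
    by (rule product_density(1)[OF \<rho> \<nu>_def])
  define R where "R x = (\<Prod>i\<in>I. \<rho> i (x i))" for x
  have R: "bounded_borel P R" unfolding R_def using \<rho>(1) bounded_borel_component by auto
  have R_nonneg: "0 \<le> R x" if "x \<in> space P" for x
    unfolding R_def using \<rho>(2) that by (intro prod_nonneg) (auto simp: space_PiM)
  have dens: "Pi\<^sub>M I \<nu> = density P (\<lambda>x. ennreal (R x))"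
    unfolding R_def by (rule product_density(2)[OF \<rho> \<nu>_def])
  \<comment> \<open>\<open>T\<close> is the divergence of the product of the marginals and
    \<open>D\<close> that of \<open>m\<close>, both from \<open>P\<close>; their difference
    \<open>D - T\<close> is the total correlation of \<open>m\<close>.\<close>
  define T where "T = (\<Sum>i\<in>I. \<integral>y. \<rho> i y * ln (\<rho> i y) \<partial>M i)"
  define D where "D = (\<integral>x. m x * ln (m x) \<partial>P)"
  define C where "C = (\<Sum>i\<in>I. (c i)\<^sup>2)"
  have kl: "kl_div (Pi\<^sub>M I \<nu>) P = ereal T"
    unfolding dens T_def using P.kl_div_density[OF R R_nonneg] entropy_product_density[OF \<rho>]
    by (simp add: R_def)
  have int_N: "(\<integral>x. g x \<partial>Pi\<^sub>M I \<nu>) = (\<integral>x. g x * R x \<partial>P)" if "bounded_borel P g" for g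
    unfolding dens using R_nonneg bounded_borel_measurable[OF that] bounded_borel_measurable[OF R]
    by (subst integral_real_density) (auto simp: mult.commute)
  have sets_N: "sets (Pi\<^sub>M I \<nu>) = sets P"
    unfolding dens by simp
  then have space_N: "space (Pi\<^sub>M I \<nu>) = space P" by (rule sets_eq_imp_space_eq)
  have pos: "0 < (\<integral>x. exp (s x) * R x \<partial>P)" if s: "bounded_borel P s" for s
  proof -
    obtain B where B: "\<And>x. x \<in> space P \<Longrightarrow> \<bar>s x\<bar> \<le> B" by (rule bounded_borelE[OF s]) blast
    have "bounded_borel (Pi\<^sub>M I \<nu>) (\<lambda>x. exp (s x))"
      using s by (subst bounded_borel_cong_sets[OF sets_N]) auto
    then have "exp (- B) \<le> (\<integral>x. exp (s x) \<partial>Pi\<^sub>M I \<nu>)"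
      using B by (intro N.P.integral_lower_bound) (auto simp: space_N abs_le_iff minus_le_iff)
    also have "\<dots> = (\<integral>x. exp (s x) * R x \<partial>P)" using s by (intro int_N) auto
    finally show ?thesis by (meson exp_gt_zero less_le_trans)
  qed
  have dv: "(\<integral>x. m x * s x \<partial>P) + T - D \<le> ln (\<integral>x. exp (s x) * R x \<partial>P)" if s: "bounded_borel P s" for s
    using donsker_varadhan_product[OF m s] pos[OF s] unfolding T_def D_def R_def \<rho>_def by simp
  \<comment> \<open>The test function 0 yields nonnegativity of the total correlation.\<close>
  have "T - D \<le> ln (\<integral>x. exp (0::real) * R x \<partial>P)" using dv[of "\<lambda>_. 0"] by simp
  also have "\<dots> = 0" using int_N[of "\<lambda>_. 1"] by (simp add: N.P.prob_space)
  finally have TD: "T \<le> D" by simp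
  have tf: "bounded_borel P (\<lambda>x. t * f x)" using f by auto
  \<comment> \<open>The exponential moment is taken under the product of the marginals, which is
    itself a product measure, so McDiarmid's bound applies to it.\<close>
  have "(\<integral>x. exp (t * f x) * R x \<partial>P) = (\<integral>x. exp (t * f x) \<partial>Pi\<^sub>M I \<nu>)"
    using f by (intro int_N[symmetric]) auto
  also have "\<dots> \<le> exp (t * (\<integral>x. f x \<partial>Pi\<^sub>M I \<nu>) + t\<^sup>2 * C / 8)"
    unfolding C_def using c f t
    by (intro N.integral_exp_bounded_differences) (auto simp: space_N bounded_borel_cong_sets[OF sets_N])
  finally have "ln (\<integral>x. exp (t * f x) * R x \<partial>P) \<le> t * (\<integral>x. f x \<partial>Pi\<^sub>M I \<nu>) + t\<^sup>2 * C / 8"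
    using pos[OF tf] by (metis exp_gt_zero ln_exp ln_le_cancel_iff)
  then have "(\<integral>x. m x * (t * f x) \<partial>P) + T - D \<le> t * (\<integral>x. f x \<partial>Pi\<^sub>M I \<nu>) + t\<^sup>2 * C / 8"
    using dv[OF tf] by linarith
  moreover have "(\<integral>x. m x * (t * f x) \<partial>P) = t * (\<integral>x. m x * f x \<partial>P)"
    by (simp add: mult.left_commute)
  ultimately have "t * (\<integral>x. m x * f x \<partial>P) \<le> t * (\<integral>x. f x \<partial>Pi\<^sub>M I \<nu>) + (D - T) + t\<^sup>2 * C / 8"
    by linarith
  also have "\<dots> = t * ((\<integral>x. f x \<partial>Pi\<^sub>M I \<nu>) + (D - T) / t + t * C / 8)"
    using t by (simp add: field_simps power2_eq_square)
  finally have 1: "(\<integral>x. m x * f x \<partial>P) \<le> (\<integral>x. f x \<partial>Pi\<^sub>M I \<nu>) + (D - T) / t + t * C / 8"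
    using t by simp
  \<comment> \<open>Each \<open>exp (u i)\<close> is a subprobability density, so the variational
    principle for the \<open>i\<close>-th marginal bounds the mean of \<open>u i\<close> by the
    entropy term of that marginal. The total correlation is thus at most the divergence of
    \<open>m\<close> from the product of the \<open>exp (u i)\<close>.\<close>
  have "(\<Sum>i\<in>I. \<integral>x. m x * u i (x i) \<partial>P) \<le> T"
    unfolding T_def
  proof (rule sum_mono)
    fix i assume i: "i \<in> I"
    obtain B where B: "\<And>y. y \<in> space (M i) \<Longrightarrow> \<bar>u i y\<bar> \<le> B" by (rule bounded_borelE[OF u[OF i]]) blast
    have "exp (- B) \<le> (\<integral>y. exp (u i y) \<partial>M i)"
      using u[OF i] B by (intro M.integral_lower_bound) (auto simp: abs_le_iff minus_le_iff)
    then have "0 < (\<integral>y. exp (u i y) \<partial>M i)" by (meson exp_gt_zero less_le_trans)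
    then have "ln (\<integral>y. exp (u i y) \<partial>M i) \<le> 0" using u1[OF i] by simp
    moreover have "(\<integral>y. \<rho> i y * u i y \<partial>M i) - (\<integral>y. \<rho> i y * ln (\<rho> i y) \<partial>M i) \<le> ln (\<integral>y. exp (u i y) \<partial>M i)"
      by (intro M.donsker_varadhan \<rho> u i)
    ultimately show "(\<integral>x. m x * u i (x i) \<partial>P) \<le> (\<integral>y. \<rho> i y * ln (\<rho> i y) \<partial>M i)"
      using integral_marginal_density[OF m(1) i u[OF i]] by (simp add: \<rho>_def)
  qed
  then have "(D - T) / t \<le> (D - (\<Sum>i\<in>I. \<integral>x. m x * u i (x i) \<partial>P)) / t"
    using t by (intro divide_right_mono) auto
  \<comment> \<open>Subtracting \<open>D\<close> from the bound on the mean of \<open>f\<close>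
    leaves \<open>- D\<close> on the right, which \<open>T \<le> D\<close> weakens to
    \<open>- T\<close>.\<close>
  then have "(\<integral>x. m x * f x \<partial>P) - D \<le> (\<integral>x. f x \<partial>Pi\<^sub>M I \<nu>) - T
      + (D - (\<Sum>i\<in>I. \<integral>x. m x * u i (x i) \<partial>P)) / t + t * C / 8"
    using 1 TD by linarith
  moreover have "sets (\<nu> i) = sets (M i)" for i by (simp add: \<nu>_def)
  ultimately show ?thesis
    using that[of \<nu> T] N.prob_space kl by (simp add: D_def C_def)
qed

section \<open>Estimates on one cell and summation over a partition\<close>

lemma override_on_singleton: "override_on x z {i} = x(i := z i)"
  by (auto simp: override_on_def fun_eq_iff)

text \<open>Here \<open>u i\<close> is the logarithmic density of the \<open>i\<close>-th factor of the product measure proportional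
  to \<open>exp (\<nabla>f(x', \<sqdot>))\<close>, whose log-partition function is \<open>\<Phi> x'\<close>. Taking \<open>x'\<close> in the cell with
  nearly minimal \<open>\<Phi>\<close> avoids a second error \<open>d\<close> from comparing \<open>\<Phi> x'\<close> with \<open>\<Phi> x\<close>.\<close>

lemma cell_bound:
  fixes f :: "('a \<Rightarrow> 'b) \<Rightarrow> real"
  defines "h \<equiv> \<lambda>i x. ln (avg {i} (\<lambda>x. exp (f x)) x)"
  assumes f: "bounded_borel P f" and t: "t > 0"
    and c: "\<And>i x z. i \<in> I \<Longrightarrow> x \<in> space P \<Longrightarrow> z \<in> space P \<Longrightarrow> \<bar>f x - f (override_on x z {i})\<bar> \<le> c i"
    and base: "\<And>i. i \<in> I \<Longrightarrow> base i \<in> space (M i)"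
    and s: "\<And>\<nu> \<kappa>. (\<And>i. i \<in> I \<Longrightarrow> prob_space (\<nu> i)) \<Longrightarrow> (\<And>i. i \<in> I \<Longrightarrow> sets (\<nu> i) = sets (M i)) \<Longrightarrow>
       kl_div (Pi\<^sub>M I \<nu>) P = ereal \<kappa> \<Longrightarrow> (\<integral>x. f x \<partial>Pi\<^sub>M I \<nu>) - \<kappa> \<le> s"
    and B: "B \<in> sets P" and r: "r < d"
    and osc: "\<And>x x'. x \<in> B \<Longrightarrow> x' \<in> B \<Longrightarrow>
      \<bar>(\<Sum>i\<in>I. f (x(i := x i)) - f (x(i := base i))) - (\<Sum>i\<in>I. f (x'(i := x i)) - f (x'(i := base i)))\<bar> \<le> r"
  defines "w \<equiv> \<integral>x. indicator B x * exp (f x) \<partial>P"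
  shows "w * ln w \<le> w * s
    + ((\<integral>x. indicator B x * exp (f x) * (f x - (\<Sum>i\<in>I. f x - h i x)) \<partial>P) - w * ln w + w * d) / t
    + w * t * (\<Sum>i\<in>I. (c i)\<^sup>2) / 8"
proof -
  have h: "bounded_borel P (h i)" for i unfolding h_def using f by auto
  note int = P.bounded_borel_integrable
  define J where "J x = f x - (\<Sum>i\<in>I. f x - h i x)" for x
  have J: "bounded_borel P J" unfolding J_def using f h by auto
  have ind: "bounded_borel P (\<lambda>x. indicator B x * exp (f x))" using B f by auto
  have w_nonneg: "w \<ge> 0" unfolding w_def by (intro integral_nonneg_AE) auto
  show ?thesis
  proof (cases "w = 0")
    \<comment> \<open>In a cell of mass 0 every term with a factor \<open>w\<close> vanishes. What
      remains is the integral of the bounded function \<open>J\<close> against a null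
      measure.\<close>
    case True
    obtain b where b: "\<And>x. x \<in> space P \<Longrightarrow> \<bar>J x\<bar> \<le> b" by (rule bounded_borelE[OF J]) blast
    have "- b * (indicator B x * exp (f x)) \<le> indicator B x * exp (f x) * J x" if "x \<in> space P" for x
      using mult_right_mono[of "- b" "J x" "indicator B x * exp (f x)"] b[OF that] by (simp add: mult.commute)
    then have "(\<integral>x. - b * (indicator B x * exp (f x)) \<partial>P) \<le> (\<integral>x. indicator B x * exp (f x) * J x \<partial>P)"
      by (intro integral_mono int bounded_borel_mult[OF ind J] bounded_borel_cmult[OF ind])
    then have "0 \<le> (\<integral>x. indicator B x * exp (f x) * J x \<partial>P)"
      using True by (simp add: w_def)
    then show ?thesis using True t by (simp add: J_def)
  next
    case False
    then have w: "w > 0" using w_nonneg by simp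
    then have "B \<noteq> {}" by (auto simp: w_def)
    have B_sub: "x \<in> space P" if "x \<in> B" for x using sets.sets_into_space[OF B] that by blast
    define \<Phi> where "\<Phi> x = (\<Sum>i\<in>I. h i x - f (x(i := base i)))" for x
    have \<Phi>: "bdd_below (\<Phi> ` B)"
    proof -
      obtain b1 where b1: "\<And>x. x \<in> space P \<Longrightarrow> \<bar>f x\<bar> \<le> b1" by (rule bounded_borelE[OF f]) blast
      have "\<exists>b. \<forall>x\<in>space P. \<bar>h i x\<bar> \<le> b" for i using h[of i] by (auto simp: bounded_borel_def)
      then obtain b2 where b2: "\<And>i x. x \<in> space P \<Longrightarrow> \<bar>h i x\<bar> \<le> b2 i" by metis
      have "(\<Sum>i\<in>I. - b2 i - b1) \<le> \<Phi> x" if "x \<in> B" for x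
        unfolding \<Phi>_def
      proof (rule sum_mono)
        fix i assume "i \<in> I"
        then have "x(i := base i) \<in> space P" using base B_sub[OF that] by (intro space_P_upd)
        then show "- b2 i - b1 \<le> h i x - f (x(i := base i))"
          using b1[of "x(i := base i)"] b2[of x i] B_sub[OF that] by simp
      qed
      then show ?thesis by (auto simp: bdd_below_def)
    qed
    obtain x' where x': "x' \<in> B" "\<And>x. x \<in> B \<Longrightarrow> \<Phi> x' \<le> \<Phi> x + (d - r)"
    proof -
      \<comment> \<open>The infimum need not be attained; the strict inequality \<open>r < d\<close>
        leaves room for a near-minimiser.\<close>
      have "Inf (\<Phi> ` B) < Inf (\<Phi> ` B) + (d - r)" using r by simp
      then obtain x' where "x' \<in> B" "\<Phi> x' < Inf (\<Phi> ` B) + (d - r)"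
        using \<open>B \<noteq> {}\<close> cInf_lessD[of "\<Phi> ` B"] by blast
      then show ?thesis using that[of x'] cINF_lower[OF \<Phi>] by force
    qed
    define u where "u i y = f (x'(i := y)) - h i x'" for i y
    have f_upd: "bounded_borel (M i) (\<lambda>y. f (x'(i := y)))" if "i \<in> I" for i
      using bounded_borel_comp[OF f measurable_fun_upd_component[OF that B_sub[OF x'(1)]]] .
    have u: "bounded_borel (M i) (u i)" if "i \<in> I" for i
      unfolding u_def using f_upd[OF that] by auto
    have u1: "(\<integral>y. exp (u i y) \<partial>M i) = 1" if i: "i \<in> I" for i
    proof -
      have "avg {i} (\<lambda>x. exp (f x)) x' = (\<integral>y. exp (f (x'(i := y))) \<partial>M i)"
        unfolding avg_def override_on_singleton using f_upd[OF i]
        by (intro integral_component[OF i, of "\<lambda>y. exp (f (x'(i := y)))"]) auto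
      moreover have "exp (h i x') = avg {i} (\<lambda>x. exp (f x)) x'"
        unfolding h_def by (rule exp_ln_avg_exp[OF f B_sub[OF x'(1)]])
      ultimately have "(\<integral>y. exp (f (x'(i := y))) \<partial>M i) = exp (h i x')" by simp
      then show ?thesis by (simp add: u_def exp_diff)
    qed
    \<comment> \<open>Moving the gradient from \<open>x\<close> to \<open>x'\<close> costs at most
      \<open>r\<close>, and replacing \<open>\<Phi> x\<close> by \<open>\<Phi> x'\<close> costs at
      most \<open>d - r\<close>, hence \<open>d\<close> in total.\<close>
    have sum_u: "(\<Sum>i\<in>I. f x - h i x) - d \<le> (\<Sum>i\<in>I. u i (x i))" if x: "x \<in> B" for x
    proof -
      have "(\<Sum>i\<in>I. u i (x i)) = (\<Sum>i\<in>I. f (x'(i := x i)) - f (x'(i := base i))) - \<Phi> x'"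
        unfolding u_def \<Phi>_def by (simp flip: sum_subtractf)
      moreover have "(\<Sum>i\<in>I. f x - h i x) = (\<Sum>i\<in>I. f (x(i := x i)) - f (x(i := base i))) - \<Phi> x"
        unfolding \<Phi>_def by (simp flip: sum_subtractf)
      ultimately show ?thesis using osc[OF x x'(1)] x'(2)[OF x] by linarith
    qed
    \<comment> \<open>This is the density of the Gibbs measure conditioned on the cell. Its
      logarithm is \<open>f - ln w\<close> there, so mean of \<open>f\<close> minus divergence is
      exactly \<open>ln w\<close>.\<close>
    define m where "m x = indicator B x * exp (f x) / w" for x
    have m: "bounded_borel P m" unfolding m_def using ind by auto
    have m_nonneg: "0 \<le> m x" for x unfolding m_def using w by simp
    have m1: "(\<integral>x. m x \<partial>P) = 1" unfolding m_def using w by (simp add: w_def)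
    have D: "(\<integral>x. m x * ln (m x) \<partial>P) = (\<integral>x. m x * f x \<partial>P) - ln w"
    proof -
      have "m x * ln (m x) = m x * f x - m x * ln w" for x
        using w by (cases "x \<in> B") (auto simp: m_def ln_div right_diff_distrib)
      then have "(\<integral>x. m x * ln (m x) \<partial>P) = (\<integral>x. m x * f x - m x * ln w \<partial>P)" by simp
      also have "\<dots> = (\<integral>x. m x * f x \<partial>P) - (\<integral>x. m x * ln w \<partial>P)"
        by (intro Bochner_Integration.integral_diff int bounded_borel_mult m f bounded_borel_const)
      finally show ?thesis by (simp add: m1)
    qed
    obtain \<nu> \<kappa> where \<nu>: "\<And>i. i \<in> I \<Longrightarrow> prob_space (\<nu> i)" "\<And>i. i \<in> I \<Longrightarrow> sets (\<nu> i) = sets (M i)"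
        "kl_div (Pi\<^sub>M I \<nu>) P = ereal \<kappa>"
      and approx: "(\<integral>x. m x * f x \<partial>P) - (\<integral>x. m x * ln (m x) \<partial>P) \<le> (\<integral>x. f x \<partial>Pi\<^sub>M I \<nu>) - \<kappa>
      + ((\<integral>x. m x * ln (m x) \<partial>P) - (\<Sum>i\<in>I. \<integral>x. m x * u i (x i) \<partial>P)) / t + t * (\<Sum>i\<in>I. (c i)\<^sup>2) / 8"
    proof (rule product_approximation[OF m m_nonneg m1 f t, of c u])
    qed (use c u u1 in auto)
    have U: "(\<integral>x. m x * f x \<partial>P) - (\<integral>x. m x * J x \<partial>P) - d \<le> (\<Sum>i\<in>I. \<integral>x. m x * u i (x i) \<partial>P)"
    proof -
      have u': "bounded_borel P (\<lambda>x. m x * u i (x i))" if "i \<in> I" for i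
        by (intro bounded_borel_mult m bounded_borel_component[OF that u[OF that]])
      have "(\<integral>x. m x * f x \<partial>P) - (\<integral>x. m x * J x \<partial>P) - d = (\<integral>x. m x * f x - m x * J x - m x * d \<partial>P)"
        using m f J m1 by (simp add: int bounded_borel_mult bounded_borel_diff)
      also have "\<dots> \<le> (\<integral>x. (\<Sum>i\<in>I. m x * u i (x i)) \<partial>P)"
      proof (intro integral_mono int bounded_borel_diff bounded_borel_mult m f J bounded_borel_const bounded_borel_sum
          bounded_borel_component u)
        fix x assume "x \<in> space P"
        show "m x * f x - m x * J x - m x * d \<le> (\<Sum>i\<in>I. m x * u i (x i))"
        proof (cases "x \<in> B")
          case True
          have "m x * ((\<Sum>i\<in>I. f x - h i x) - d) \<le> m x * (\<Sum>i\<in>I. u i (x i))"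
            by (intro mult_left_mono sum_u True m_nonneg)
          then show ?thesis by (simp add: J_def algebra_simps sum_distrib_left)
        qed (simp add: m_def)
      qed auto
      also have "\<dots> = (\<Sum>i\<in>I. \<integral>x. m x * u i (x i) \<partial>P)"
        using u' by (intro Bochner_Integration.integral_sum int)
      finally show ?thesis .
    qed
    have "ln w \<le> (\<integral>x. f x \<partial>Pi\<^sub>M I \<nu>) - \<kappa>
      + ((\<integral>x. m x * f x \<partial>P) - ln w - (\<Sum>i\<in>I. \<integral>x. m x * u i (x i) \<partial>P)) / t + t * (\<Sum>i\<in>I. (c i)\<^sup>2) / 8"
      using approx by (simp add: D)
    also have "\<dots> \<le> s + ((\<integral>x. m x * J x \<partial>P) - ln w + d) / t + t * (\<Sum>i\<in>I. (c i)\<^sup>2) / 8"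
      using U t by (intro add_mono s \<nu> divide_right_mono) auto
    finally have "w * ln w \<le> w * (s + ((\<integral>x. m x * J x \<partial>P) - ln w + d) / t + t * (\<Sum>i\<in>I. (c i)\<^sup>2) / 8)"
      using w by (intro mult_left_mono) auto
    also have "\<dots> = w * s + (w * (\<integral>x. m x * J x \<partial>P) - w * ln w + w * d) / t + w * t * (\<Sum>i\<in>I. (c i)\<^sup>2) / 8"
      using t by (simp add: field_simps)
    also have "w * (\<integral>x. m x * J x \<partial>P) = (\<integral>x. indicator B x * exp (f x) * J x \<partial>P)"
      using w by (subst integral_mult_right_zero[symmetric]) (simp add: m_def)
    finally show ?thesis by (simp add: J_def)
  qed
qed

text \<open>The entropy of the weights \<open>w k / Z\<close> is at most \<open>ln N\<close>: sum
  the tangent line of \<open>y * ln y\<close> at the uniform value \<open>a = Z / N\<close>.\<close>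

lemma sum_mult_ln_ge:
  fixes w :: "nat \<Rightarrow> real"
  assumes "\<And>k. k < N \<Longrightarrow> 0 \<le> w k" "(\<Sum>k<N. w k) = Z" "Z > 0"
  shows "Z * ln Z - Z * ln (real N) \<le> (\<Sum>k<N. w k * ln (w k))"
proof -
  have N: "N > 0" using assms by (cases N) auto
  define a where "a = Z / real N"
  have a: "a > 0" using N assms by (simp add: a_def)
  have "y * ln a + y - a \<le> y * ln y" if "y \<ge> 0" for y :: real
  proof (cases "y = 0")
    case False
    then have y: "y > 0" using that by simp
    have "y * ln (a / y) \<le> y * (a / y - 1)"
      using a y by (intro mult_left_mono ln_le_minus_one) auto
    then show ?thesis using a y by (simp add: ln_div right_diff_distrib)
  qed (use a in simp)
  then have "(\<Sum>k<N. w k * ln a + w k - a) \<le> (\<Sum>k<N. w k * ln (w k))"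
    using assms by (intro sum_mono) auto
  moreover have "(\<Sum>k<N. w k * ln a + w k - a) = Z * ln a + Z - real N * a"
    using assms(2) by (simp add: sum.distrib sum_subtractf sum_distrib_right[symmetric])
  moreover have "real N * a = Z" "ln a = ln Z - ln (real N)"
    using N assms(3) by (simp_all add: a_def ln_div)
  ultimately show ?thesis by (simp add: right_diff_distrib)
qed

text \<open>Summing the cell bounds recombines the integrals of \<open>exp f * J\<close> into one,
  which Han's inequality bounds by \<open>Z * ln Z\<close>. The partition entropy, at most
  \<open>ln N\<close>, then enters twice: once in splitting the Gibbs measure, and once, divided by
  \<open>t\<close>, in the mean total correlation.\<close>

lemma partition_bound:
  fixes f :: "('a \<Rightarrow> 'b) \<Rightarrow> real" and A :: "nat \<Rightarrow> ('a \<Rightarrow> 'b) set"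
  assumes f: "bounded_borel P f" and t: "t > 0"
    and c: "\<And>i x z. i \<in> I \<Longrightarrow> x \<in> space P \<Longrightarrow> z \<in> space P \<Longrightarrow> \<bar>f x - f (override_on x z {i})\<bar> \<le> c i"
    and base: "\<And>i. i \<in> I \<Longrightarrow> base i \<in> space (M i)"
    and s: "\<And>\<nu> \<kappa>. (\<And>i. i \<in> I \<Longrightarrow> prob_space (\<nu> i)) \<Longrightarrow> (\<And>i. i \<in> I \<Longrightarrow> sets (\<nu> i) = sets (M i)) \<Longrightarrow>
       kl_div (Pi\<^sub>M I \<nu>) P = ereal \<kappa> \<Longrightarrow> (\<integral>x. f x \<partial>Pi\<^sub>M I \<nu>) - \<kappa> \<le> s"
    and A: "\<And>k. k < N \<Longrightarrow> A k \<in> sets P" "(\<Union>k<N. A k) = space P"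
    and r: "\<And>k. k < N \<Longrightarrow> r k < d"
    and osc: "\<And>k x x' y. k < N \<Longrightarrow> x \<in> A k \<Longrightarrow> x' \<in> A k \<Longrightarrow> y \<in> space P \<Longrightarrow>
      \<bar>(\<Sum>i\<in>I. f (x(i := y i)) - f (x(i := base i))) - (\<Sum>i\<in>I. f (x'(i := y i)) - f (x'(i := base i)))\<bar> \<le> r k"
  shows "ln (\<integral>x. exp (f x) \<partial>P) \<le> s + ln (real N) + (ln (real N) + d) / t + t * (\<Sum>i\<in>I. (c i)\<^sup>2) / 8"
proof -
  define h where "h i x = ln (avg {i} (\<lambda>x. exp (f x)) x)" for i x
  have h: "bounded_borel P (h i)" for i unfolding h_def using f by auto
  note int = P.bounded_borel_integrable
  define J where "J x = f x - (\<Sum>i\<in>I. f x - h i x)" for x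
  have J: "bounded_borel P J" unfolding J_def using f h by auto
  define C where "C = (\<Sum>i\<in>I. (c i)\<^sup>2)"
  define Z where "Z = (\<integral>x. exp (f x) \<partial>P)"
  obtain b where b: "\<And>x. x \<in> space P \<Longrightarrow> \<bar>f x\<bar> \<le> b" by (rule bounded_borelE[OF f]) blast
  have "exp (- b) \<le> Z"
    unfolding Z_def using f b by (intro P.integral_lower_bound) (auto simp: abs_le_iff minus_le_iff)
  then have Z: "Z > 0" by (meson exp_gt_zero less_le_trans)
  have han: "(\<integral>x. exp (f x) * J x \<partial>P) \<le> Z * ln Z"
  proof -
    have "(\<integral>x. exp (f x) * (f x - ln Z) \<partial>P) \<le> (\<Sum>i\<in>I. \<integral>x. exp (f x) * (f x - h i x) \<partial>P)"
      using entropy_tensorization[OF f] by (simp add: Z_def h_def)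
    moreover have "(\<integral>x. exp (f x) * (f x - ln Z) \<partial>P) = (\<integral>x. exp (f x) * f x \<partial>P) - Z * ln Z"
    proof -
      have "(\<integral>x. exp (f x) * (f x - ln Z) \<partial>P) = (\<integral>x. exp (f x) * f x - exp (f x) * ln Z \<partial>P)"
        by (simp add: right_diff_distrib)
      also have "\<dots> = (\<integral>x. exp (f x) * f x \<partial>P) - (\<integral>x. exp (f x) * ln Z \<partial>P)"
        using f by (intro Bochner_Integration.integral_diff int) auto
      finally show ?thesis by (simp add: Z_def)
    qed
    moreover have "(\<integral>x. exp (f x) * J x \<partial>P)
        = (\<integral>x. exp (f x) * f x \<partial>P) - (\<Sum>i\<in>I. \<integral>x. exp (f x) * (f x - h i x) \<partial>P)"
    proof -
      have "(\<integral>x. exp (f x) * J x \<partial>P) = (\<integral>x. exp (f x) * f x - (\<Sum>i\<in>I. exp (f x) * (f x - h i x)) \<partial>P)"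
        by (simp only: J_def right_diff_distrib sum_distrib_left)
      also have "\<dots> = (\<integral>x. exp (f x) * f x \<partial>P) - (\<integral>x. (\<Sum>i\<in>I. exp (f x) * (f x - h i x)) \<partial>P)"
        using f h by (intro Bochner_Integration.integral_diff int) auto
      also have "(\<integral>x. (\<Sum>i\<in>I. exp (f x) * (f x - h i x)) \<partial>P) = (\<Sum>i\<in>I. \<integral>x. exp (f x) * (f x - h i x) \<partial>P)"
        using f h by (intro Bochner_Integration.integral_sum int) auto
      finally show ?thesis .
    qed
    ultimately show ?thesis by linarith
  qed
  \<comment> \<open>The sets \<open>A k\<close> may overlap; each point is assigned to the first one
    containing it.\<close>
  define B where "B k = A k - (\<Union>j<k. A j)" for k
  have B: "B k \<in> sets P" if "k < N" for k
    unfolding B_def using that A(1) by (intro sets.Diff sets.finite_UN) auto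
  have ind: "(\<Sum>k<N. indicator (B k) x) = (1::real)" if "x \<in> space P" for x
  proof -
    from that A(2) have ex: "\<exists>k. k < N \<and> x \<in> A k" by blast
    define k0 where "k0 = (LEAST k. k < N \<and> x \<in> A k)"
    have k0: "k0 < N" "x \<in> A k0" using LeastI_ex[OF ex] by (auto simp: k0_def)
    have "x \<in> B k \<longleftrightarrow> k = k0" if "k < N" for k
    proof
      assume "x \<in> B k"
      then have "x \<in> A k" "\<And>j. j < k \<Longrightarrow> x \<notin> A j" by (auto simp: B_def)
      moreover from this have "k0 \<le> k" using that Least_le[of "\<lambda>k. k < N \<and> x \<in> A k" k] by (auto simp: k0_def)
      ultimately show "k = k0" using k0(2) by (metis le_neq_implies_less)
    next
      assume "k = k0"
      moreover have "x \<notin> A j" if "j < k0" for j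
        using not_less_Least[of j "\<lambda>k. k < N \<and> x \<in> A k"] that k0(1) by (simp add: k0_def)
      ultimately show "x \<in> B k" using k0(2) by (auto simp: B_def)
    qed
    then have "(\<Sum>k<N. indicator (B k) x) = (\<Sum>k<N. if k = k0 then 1 else (0::real))"
      by (intro sum.cong) (auto simp: indicator_def)
    then show ?thesis using k0 by simp
  qed
  have decomp: "(\<Sum>k<N. \<integral>x. indicator (B k) x * g x \<partial>P) = (\<integral>x. g x \<partial>P)" if "bounded_borel P g" for g
  proof -
    have "(\<Sum>k<N. \<integral>x. indicator (B k) x * g x \<partial>P) = (\<integral>x. (\<Sum>k<N. indicator (B k) x * g x) \<partial>P)"
      using that B by (intro Bochner_Integration.integral_sum[symmetric] int) auto
    also have "\<dots> = (\<integral>x. g x \<partial>P)"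
      by (intro Bochner_Integration.integral_cong refl) (simp add: ind flip: sum_distrib_right)
    finally show ?thesis .
  qed
  define w where "w k = (\<integral>x. indicator (B k) x * exp (f x) \<partial>P)" for k
  define W where "W = (\<Sum>k<N. w k * ln (w k))"
  have w_sum: "(\<Sum>k<N. w k) = Z" unfolding w_def Z_def using f by (intro decomp) auto
  have "w k * ln (w k) \<le> w k * s
    + ((\<integral>x. indicator (B k) x * exp (f x) * J x \<partial>P) - w k * ln (w k) + w k * d) / t
    + w k * t * C / 8" if k: "k < N" for k
    unfolding w_def J_def C_def h_def
  \<comment> \<open>Each \<open>B k\<close> inherits the oscillation bound of \<open>A k\<close>,
    taken at \<open>y = x\<close>.\<close>
  proof (rule cell_bound[OF f t c base s B[OF k] r[OF k]])
    fix x x' assume x: "x \<in> B k" "x' \<in> B k"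
    then show "\<bar>(\<Sum>i\<in>I. f (x(i := x i)) - f (x(i := base i))) - (\<Sum>i\<in>I. f (x'(i := x i)) - f (x'(i := base i)))\<bar> \<le> r k"
      using sets.sets_into_space[OF A(1)[OF k]] by (intro osc k) (auto simp: B_def)
  qed
  then have "W \<le> (\<Sum>k<N. w k * s
    + ((\<integral>x. indicator (B k) x * exp (f x) * J x \<partial>P) - w k * ln (w k) + w k * d) / t
    + w k * t * C / 8)"
    unfolding W_def by (intro sum_mono) auto
  also have "\<dots> = (\<Sum>k<N. w k) * s + ((\<Sum>k<N. \<integral>x. indicator (B k) x * (exp (f x) * J x) \<partial>P) - W + (\<Sum>k<N. w k) * d) / t
      + (\<Sum>k<N. w k) * t * C / 8"
    unfolding W_def
    by (simp only: sum.distrib sum_subtractf sum_distrib_right sum_divide_distrib mult.assoc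
        add_divide_distrib diff_divide_distrib)
  also have "(\<Sum>k<N. \<integral>x. indicator (B k) x * (exp (f x) * J x) \<partial>P) = (\<integral>x. exp (f x) * J x \<partial>P)"
    using f J by (intro decomp) auto
  finally have "W \<le> Z * s + ((\<integral>x. exp (f x) * J x \<partial>P) - W + Z * d) / t + Z * t * C / 8"
    unfolding w_sum .
  also have "\<dots> \<le> Z * s + (Z * ln Z - W + Z * d) / t + Z * t * C / 8"
    using han t by (intro add_mono divide_right_mono) auto
  finally have "W \<le> Z * s + (Z * ln Z - W + Z * d) / t + Z * t * C / 8" .
  moreover have WZ: "Z * ln Z - Z * ln (real N) \<le> W"
    unfolding W_def using w_sum Z by (intro sum_mult_ln_ge) (auto simp: w_def intro!: integral_nonneg_AE)
  moreover have "(Z * ln Z - W + Z * d) / t \<le> (Z * ln (real N) + Z * d) / t"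
    using WZ t by (intro divide_right_mono) auto
  ultimately have "Z * ln Z \<le> Z * s + Z * ln (real N) + (Z * ln (real N) + Z * d) / t + Z * t * C / 8"
    by linarith
  also have "\<dots> = Z * (s + ln (real N) + (ln (real N) + d) / t + t * C / 8)"
    using t by (simp add: field_simps)
  finally show ?thesis using Z by (simp add: Z_def C_def)
qed

end

section \<open>Covering the set of gradients\<close>

lemma sets_borel_of: "sets (borel_of X) = sigma_sets (topspace X) {U. openin X U}"
  unfolding borel_of_def using openin_subset by (intro sets_measure_of) blast

lemma openin_sets_borel_of: "openin X U \<Longrightarrow> U \<in> sets (borel_of X)"
  unfolding sets_borel_of by blast

lemma space_borel_of: "space (borel_of X) = topspace X"
  unfolding borel_of_def using openin_subset by (intro space_measure_of) blast

text \<open>The base consists of the balls of radius \<open>1 / Suc k\<close> about a countable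
  dense set; a radius below half of \<open>r\<close> keeps such a ball inside the given one.\<close>

lemma separable_metric_second_countable:
  assumes "separable_space (mtopology_of m)"
  shows "second_countable (mtopology_of m)"
proof -
  interpret Metric_space "mspace m" "mdist m" by simp
  have top: "mtopology_of m = mtopology" by (simp add: mtopology_of_def)
  obtain C where C: "countable C" "C \<subseteq> mspace m" "mtopology closure_of C = mspace m"
    using assms unfolding separable_space_def top by auto
  define \<B> where "\<B> = (\<lambda>(x, k). mball x (1 / real (Suc k))) ` (C \<times> (UNIV :: nat set))"
  have "\<exists>V\<in>\<B>. y \<in> V \<and> V \<subseteq> U" if U: "openin mtopology U" and y: "y \<in> U" for U y
  proof -
    obtain r where r: "r > 0" "mball y r \<subseteq> U" using U y openin_mtopology by blast
    have ym: "y \<in> mspace m" using U y openin_mtopology by blast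
    obtain k where k: "1 / real (Suc k) < r / 2"
      using nat_approx_posE[of "r / 2"] r by auto
    let ?e = "1 / real (Suc k)"
    have "y \<in> mtopology closure_of C" using C(3) ym by simp
    then have "\<forall>r>0. \<exists>x\<in>C. x \<in> mball y r" unfolding metric_closure_of by blast
    moreover have "?e > 0" by simp
    ultimately obtain x where x: "x \<in> C" "x \<in> mball y ?e" by blast
    have "mball x ?e \<subseteq> mball y r"
    proof
      fix z assume "z \<in> mball x ?e"
      then have z: "z \<in> mspace m" "mdist m x z < ?e" by auto
      moreover have "mdist m y z \<le> mdist m y x + mdist m x z"
        using x z ym by (intro triangle) auto
      ultimately show "z \<in> mball y r" using x k ym by auto
    qed
    moreover have "y \<in> mball x ?e" using x ym by (auto simp: commute)
    moreover have "mball x ?e \<in> \<B>" using x(1) by (auto simp: \<B>_def)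
    ultimately show ?thesis using r(2) by blast
  qed
  moreover have "countable \<B>" unfolding \<B>_def using C(1) by auto
  moreover have "\<forall>V\<in>\<B>. openin mtopology V" by (auto simp: \<B>_def)
  ultimately show ?thesis unfolding second_countable_def top by blast
qed

text \<open>Second countability makes every open set of the product a countable union of boxes.\<close>

lemma openin_product_measurable:
  assumes "finite I" and X: "\<And>i. i \<in> I \<Longrightarrow> second_countable (X i)"
    and M: "\<And>i. i \<in> I \<Longrightarrow> sets (M i) = sets (borel_of (X i))"
    and S: "openin (product_topology X I) S"
  shows "S \<in> sets (Pi\<^sub>M I M)"
proof -
  have "\<exists>\<B>. countable \<B> \<and> (\<forall>V\<in>\<B>. openin (X i) V) \<and>
      (\<forall>U x. openin (X i) U \<and> x \<in> U \<longrightarrow> (\<exists>V\<in>\<B>. x \<in> V \<and> V \<subseteq> U))" if "i \<in> I" for i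
    using X[OF that] unfolding second_countable_def .
  then obtain \<B> where \<B>: "\<And>i. i \<in> I \<Longrightarrow> countable (\<B> i)" "\<And>i V. i \<in> I \<Longrightarrow> V \<in> \<B> i \<Longrightarrow> openin (X i) V"
    "\<And>i U x. i \<in> I \<Longrightarrow> openin (X i) U \<Longrightarrow> x \<in> U \<Longrightarrow> \<exists>V\<in>\<B> i. x \<in> V \<and> V \<subseteq> U"
    by metis
  define \<V> where "\<V> = {V \<in> Pi\<^sub>E I \<B>. Pi\<^sub>E I V \<subseteq> S}"
  have "countable (Pi\<^sub>E I \<B>)" using assms(1) \<B>(1) by (rule countable_PiE)
  then have "countable \<V>" unfolding \<V>_def by (rule countable_subset[rotated]) blast
  moreover have "Pi\<^sub>E I V \<in> sets (Pi\<^sub>M I M)" if "V \<in> \<V>" for V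
    using that \<B>(2) M assms(1)
    by (intro sets_PiM_I_finite) (auto simp: \<V>_def PiE_iff intro!: openin_sets_borel_of)
  ultimately have "(\<Union>V\<in>\<V>. Pi\<^sub>E I V) \<in> sets (Pi\<^sub>M I M)"
    by (intro sets.countable_UN') auto
  moreover have "S = (\<Union>V\<in>\<V>. Pi\<^sub>E I V)"
  proof
    show "S \<subseteq> (\<Union>V\<in>\<V>. Pi\<^sub>E I V)"
    proof
      fix x assume "x \<in> S"
      then obtain U where U: "\<forall>i\<in>I. openin (X i) (U i)" "x \<in> Pi\<^sub>E I U" "Pi\<^sub>E I U \<subseteq> S"
        using S unfolding openin_product_topology_alt by meson
      have "\<exists>V\<in>\<B> i. x i \<in> V \<and> V \<subseteq> U i" if "i \<in> I" for i
        using \<B>(3)[OF that] U that by (auto simp: PiE_iff)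
      then obtain V where V: "\<And>i. i \<in> I \<Longrightarrow> V i \<in> \<B> i \<and> x i \<in> V i \<and> V i \<subseteq> U i" by metis
      \<comment> \<open>Restricting to \<open>I\<close> changes no box but puts the family of sides
        into the countable set \<open>Pi\<^sub>E I \<B>\<close>.\<close>
      have eq: "Pi\<^sub>E I (restrict V I) = Pi\<^sub>E I V" by (rule PiE_cong) simp
      have "Pi\<^sub>E I V \<subseteq> Pi\<^sub>E I U" using V by (intro PiE_mono) blast
      then have "Pi\<^sub>E I (restrict V I) \<subseteq> S" using U(3) unfolding eq by (rule order_trans)
      moreover have "restrict V I \<in> Pi\<^sub>E I \<B>" using V by (intro restrict_PiE_iff[THEN iffD2]) blast
      ultimately have "restrict V I \<in> \<V>" unfolding \<V>_def by blast
      moreover have "x \<in> Pi\<^sub>E I (restrict V I)"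
        unfolding eq using V PiE_arb[OF U(2)] by (intro PiE_I) blast+
      ultimately show "x \<in> (\<Union>V\<in>\<V>. Pi\<^sub>E I V)" by blast
    qed
  qed (auto simp: \<V>_def)
  ultimately show ?thesis by simp
qed

section \<open>From a covering of the gradients to measurable cells\<close>

text \<open>With one argument fixed, the bound defines a closed set, so it passes to the closure one
  argument at a time. Cells can thereby be made closed, hence Borel, at no cost in
  oscillation.\<close>

lemma closure_of_oscillation_le:
  fixes g :: "'a \<Rightarrow> real"
  assumes g: "continuous_map X euclideanreal g"
    and T: "\<And>x x'. x \<in> T \<Longrightarrow> x' \<in> T \<Longrightarrow> \<bar>g x - g x'\<bar> \<le> r"
    and x: "x \<in> X closure_of T" "x' \<in> X closure_of T"
  shows "\<bar>g x - g x'\<bar> \<le> r"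
proof -
  have cl: "\<bar>g x - a\<bar> \<le> r" if "\<And>x. x \<in> T \<Longrightarrow> \<bar>g x - a\<bar> \<le> r" "x \<in> X closure_of T" for a x
  proof -
    have "closedin X {x \<in> topspace X. g x \<in> {a - r..a + r}}"
      by (rule closedin_continuous_map_preimage[OF g]) simp
    moreover have "topspace X \<inter> T \<subseteq> {x \<in> topspace X. g x \<in> {a - r..a + r}}"
      using that(1) by (force simp: abs_le_iff)
    ultimately have "X closure_of (topspace X \<inter> T) \<subseteq> {x \<in> topspace X. g x \<in> {a - r..a + r}}"
      by (intro closure_of_minimal)
    then show ?thesis using that(2) closure_of_restrict[of X T] by (auto simp: abs_le_iff)
  qed
  have "\<bar>g x' - g y\<bar> \<le> r" if "y \<in> T" for y using cl[OF T[OF _ that] x(2)] .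
  then show ?thesis by (intro cl[OF _ x(1)]) (subst abs_minus_commute)
qed

text \<open>A finite infimum of extended naturals is attained, so an optimal covering exists. Some
  finite covering exists at all because the infimum of the empty set would be infinite.\<close>

lemma covering_number_leE:
  assumes "ereal_of_enat (covering_number m r F) \<le> ereal a"
  obtains C where "finite C" "F \<subseteq> \<Union>C" "\<And>S. S \<in> C \<Longrightarrow> S \<subseteq> mspace m" "\<And>S. S \<in> C \<Longrightarrow> mdiameter m S < ennreal r"
    "real (card C) \<le> a"
proof -
  let ?\<C> = "{C. finite C \<and> F \<subseteq> \<Union>C \<and> (\<forall>S\<in>C. S \<subseteq> mspace m \<and> mdiameter m S < ennreal r)}"
  let ?N = "(\<lambda>C. enat (card C)) ` ?\<C>"
  have nonempty: "?N \<noteq> {}"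
  proof
    assume empty: "?N = {}"
    have "covering_number m r F = Inf ?N" by (simp only: covering_number_def)
    also have "\<dots> = Inf {}" by (rule arg_cong[OF empty])
    also have "Inf {} = (\<infinity> :: enat)" by (simp add: Inf_enat_def)
    finally have "covering_number m r F = \<infinity>" .
    then show False using assms by simp
  qed
  have Inf_in: "Inf A \<in> A" if "A \<noteq> {}" for A :: "enat set"
    using LeastI_ex[of "\<lambda>x. x \<in> A"] that unfolding Inf_enat_def by auto
  have "covering_number m r F \<in> ?N"
    unfolding covering_number_def by (rule Inf_in[OF nonempty])
  then obtain C where C: "C \<in> ?\<C>" "covering_number m r F = enat (card C)" by (rule imageE)
  show ?thesis using assms C by (intro that[of C]) auto
qed

lemma mdist_le_mdiameter: "x \<in> S \<Longrightarrow> y \<in> S \<Longrightarrow> ennreal (mdist m x y) \<le> mdiameter m S"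
  unfolding mdiameter_def by (meson SUP_upper order_trans)

text \<open>Take \<open>r\<close> to be the diameter itself. Its strict gap below \<open>d\<close>
  is kept, since the choice of a reference point in each cell consumes it.\<close>

lemma funspace_diff_le:
  assumes "mdiameter (funspace D (euclidean_metric :: real metric)) S < ennreal d"
    and "S \<subseteq> mspace (funspace D (euclidean_metric :: real metric))"
  obtains r where "r < d" "\<And>g h y. g \<in> S \<Longrightarrow> h \<in> S \<Longrightarrow> y \<in> D \<Longrightarrow> \<bar>g y - h y\<bar> \<le> r"
proof -
  let ?F = "funspace D (euclidean_metric :: real metric)"
  let ?r = "enn2real (mdiameter ?F S)"
  have fin: "mdiameter ?F S < top" using assms(1) by (rule less_trans) simp
  have "?r < d"
    using assms(1) fin by (metis enn2real_nonneg ennreal_enn2real ennreal_less_iff)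
  moreover have "\<bar>g y - h y\<bar> \<le> ?r" if "g \<in> S" "h \<in> S" "y \<in> D" for g h y
  proof -
    have gh: "g \<in> Met_TC.fspace D" "h \<in> Met_TC.fspace D" using assms(2) that by auto
    have "\<bar>g y - h y\<bar> = mdist euclidean_metric (g y) (h y)" by (simp add: dist_real_def)
    also have "\<dots> \<le> mdist ?F g h"
      using gh that(3) by (auto simp: Met_TC.fdist_def intro!: cSUP_upper Met_TC.bdd_above_dist)
    also have "\<dots> \<le> ?r"
      using mdist_le_mdiameter[OF that(1,2), of ?F] fin
      by (metis enn2real_ennreal enn2real_mono mdist_nonneg)
    finally show ?thesis .
  qed
  ultimately show ?thesis using that by blast
qed

text \<open>For \<open>L > 0\<close> the two terms balance at
  \<open>t = 4 * q * sqrt (a / 2) / L\<close>, with sum exactly \<open>sqrt (a / 2) * L\<close>. For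
  \<open>L = 0\<close> the infimum is only approached as \<open>t\<close> grows, and the slack
  \<open>d\<close> absorbs the remainder.\<close>

lemma exists_optimal_parameter:
  fixes a d L q :: real
  assumes "a > 0" "d > 0" "L \<ge> 0" "q > 0"
  shows "\<exists>t>0. a * q / t + t * L\<^sup>2 / (8 * q) \<le> sqrt (a / 2) * L + d"
proof (cases "L = 0")
  case True
  then show ?thesis using assms by (intro exI[of _ "a * q / d"]) simp
next
  case False
  then have L: "L > 0" using assms by simp
  define b where "b = sqrt (a / 2)"
  have b: "b > 0" "a = 2 * b\<^sup>2" using assms by (simp_all add: b_def)
  define t where "t = 4 * q * b / L"
  have "a * q / t + t * L\<^sup>2 / (8 * q) = b * L"
    using b L assms unfolding b(2) t_def by (simp add: field_simps power2_eq_square)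
  moreover have "t > 0" using b L assms by (simp add: t_def)
  ultimately show ?thesis using assms by (intro exI[of _ t]) (simp add: b_def)
qed

lemma continuous_map_fun_upd:
  assumes "i \<in> I" "a \<in> topspace (X i)"
  shows "continuous_map (product_topology X I) (product_topology X I) (\<lambda>x. x(i := a))"
  unfolding continuous_map_componentwise
proof (intro conjI ballI)
  show "(\<lambda>x. x(i := a)) ` topspace (product_topology X I) \<subseteq> extensional I"
    using assms by (auto simp: PiE_def extensional_def)
  fix k assume k: "k \<in> I"
  show "continuous_map (product_topology X I) (X k) (\<lambda>x. (x(i := a)) k)"
    using assms k by (cases "k = i") (auto simp: continuous_map_product_projection)
qed

section \<open>Application to the metric product and choice of the parameter\<close>

theorem proposition5p1:
  fixes n :: nat
    and K :: "nat \<Rightarrow> 'a metric"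
    and lam :: "nat \<Rightarrow> 'a measure"
    and base :: "nat \<Rightarrow> 'a"
    and f :: "(nat \<Rightarrow> 'a) \<Rightarrow> real"
    and L \<delta> \<epsilon> :: real
  assumes "n \<ge> 1"
    and "\<And>i. i \<in> {1..n} \<Longrightarrow> mspace (K i) \<noteq> {}"
    and "\<And>i. i \<in> {1..n} \<Longrightarrow> mcomplete_of (K i)"
    and "\<And>i. i \<in> {1..n} \<Longrightarrow> separable_space (mtopology_of (K i))"
    and "\<And>i. i \<in> {1..n} \<Longrightarrow> mdiameter (K i) (mspace (K i)) \<le> 1"
    and "\<And>i. i \<in> {1..n} \<Longrightarrow> prob_space (lam i)"
    and "\<And>i. i \<in> {1..n} \<Longrightarrow> sets (lam i) = sets (borel_of (mtopology_of (K i)))"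
    and "\<And>i. i \<in> {1..n} \<Longrightarrow> base i \<in> mspace (K i)"
    and "bounded (f ` prod_mspace n K)"
    and "continuous_map (prod_mtopology n K) euclideanreal f"
    and "L \<ge> 0" and "\<delta> > 0"
    and "\<And>x y. x \<in> prod_mspace n K \<Longrightarrow> y \<in> prod_mspace n K \<Longrightarrow>
           \<bar>f x - f y\<bar> \<le> L * avg_dist n K x y"
    and "ereal_of_enat
           (covering_number (funspace (prod_mspace n K) (euclidean_metric :: real metric)) (\<delta> * real n)
             ((\<lambda>x. restrict (discrete_grad n base f x) (prod_mspace n K)) ` prod_mspace n K))
         \<le> ereal (exp (\<epsilon> * real n))"
  shows "ereal (ln (\<integral>x. exp (f x) \<partial>Pi\<^sub>M {1..n} lam))
         \<le> (SUP \<xi>\<in>product_prob_measures n K.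
              ereal (\<integral>x. f x \<partial>\<xi>) - kl_div \<xi> (Pi\<^sub>M {1..n} lam))
           + ereal ((\<epsilon> + \<delta>) * real n) + ereal (sqrt ((\<epsilon> + \<delta>) / 2) * L)"
proof -
  note n = assms(1) and separable = assms(4) and diam = assms(5) and prob_lam = assms(6)
    and sets_lam = assms(7) and base = assms(8) and f_bounded = assms(9) and f_cont = assms(10)
    and L = assms(11) and \<delta> = assms(12) and f_lipschitz = assms(13) and cov = assms(14)
  note One_nat_def [simp del]
  \<comment> \<open>Outside \<open>{1..n}\<close> the family repeats \<open>lam 1\<close>, a
    probability measure because \<open>n \<ge> 1\<close>.\<close>
  define \<Lambda> where "\<Lambda> i = lam (if i \<in> {1..n} then i else 1)" for i
  have prob_\<Lambda>: "prob_space (\<Lambda> i)" for i using prob_lam n by (simp add: \<Lambda>_def)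
  have sets_\<Lambda>: "sets (\<Lambda> i) = sets (borel_of (mtopology_of (K i)))" if "i \<in> {1..n}" for i
    using sets_lam that by (simp add: \<Lambda>_def)
  have space_\<Lambda>: "space (\<Lambda> i) = mspace (K i)" if "i \<in> {1..n}" for i
    using sets_eq_imp_space_eq[OF sets_\<Lambda>[OF that]] by (simp add: space_borel_of)
  have lam_eq: "Pi\<^sub>M {1..n} lam = Pi\<^sub>M {1..n} \<Lambda>" by (intro PiM_cong) (auto simp: \<Lambda>_def)
  interpret finite_product_prob_space \<Lambda> "{1..n}"
    using prob_\<Lambda> by (intro finite_product_prob_spaceI) auto
  let ?X = "prod_mtopology n K"
  have space_P: "space P = prod_mspace n K"
    unfolding space_PiM using space_\<Lambda> by (intro PiE_cong) auto
  have top_X: "topspace ?X = space P" unfolding space_P by simp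
  have open_meas: "U \<in> sets P" if "openin ?X U" for U
    using separable sets_\<Lambda> that
    by (intro openin_product_measurable[of _ "\<lambda>i. mtopology_of (K i)"] separable_metric_second_countable) auto
  have closed_meas: "U \<in> sets P" if "closedin ?X U" for U
  proof -
    have "openin ?X (space P - U)" "U \<subseteq> space P"
      using that unfolding closedin_def top_X by auto
    then show ?thesis using sets.compl_sets[OF open_meas, of "space P - U"] by (simp add: double_diff)
  qed
  have f: "bounded_borel P f"
  proof -
    obtain B where "\<forall>y \<in> f ` space P. \<bar>y\<bar> \<le> B"
      using f_bounded unfolding space_P bounded_iff by auto
    moreover have "f \<in> borel_measurable P"
    proof (rule borel_measurableI)
      fix S :: "real set" assume "open S"
      then have "openin ?X {x \<in> topspace ?X. f x \<in> S}"
        by (intro openin_continuous_map_preimage[OF f_cont]) simp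
      moreover have "{x \<in> topspace ?X. f x \<in> S} = f -` S \<inter> space P" unfolding top_X by blast
      ultimately show "f -` S \<inter> space P \<in> sets P" using open_meas by simp
    qed
    ultimately show ?thesis by (intro bounded_borelI[of _ _ B]) auto
  qed
  have dist_le_1: "mdist (K i) x y \<le> 1" if "i \<in> {1..n}" "x \<in> mspace (K i)" "y \<in> mspace (K i)" for i x y
    using order_trans[OF mdist_le_mdiameter[OF that(2,3)] diam[OF that(1)]] by simp
  \<comment> \<open>Changing one coordinate moves a point by at most \<open>1 / n\<close> in the
    averaged metric, as each factor has diameter at most 1.\<close>
  have diff: "\<bar>f x - f (override_on x z {i})\<bar> \<le> L / real n"
    if i: "i \<in> {1..n}" and x: "x \<in> space P" and z: "z \<in> space P" for i x z
  proof -
    have xz: "x k \<in> mspace (K k)" "z k \<in> mspace (K k)" if "k \<in> {1..n}" for k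
      using x z that unfolding space_P by auto
    have "(\<Sum>k=1..n. mdist (K k) (x k) (override_on x z {i} k)) = (\<Sum>k=1..n. if k = i then mdist (K i) (x i) (z i) else 0)"
      using xz by (intro sum.cong refl) (auto simp: override_on_def)
    also have "\<dots> \<le> 1" using i xz dist_le_1 by simp
    finally have "avg_dist n K x (override_on x z {i}) \<le> 1 / real n"
      unfolding avg_dist_def using n by (simp add: field_simps)
    then have "L * avg_dist n K x (override_on x z {i}) \<le> L * (1 / real n)"
      using L by (intro mult_left_mono) auto
    then show ?thesis
      using f_lipschitz[of x "override_on x z {i}"] x space_P_override[OF x z] unfolding space_P by simp
  qed
  have base': "base i \<in> space (\<Lambda> i)" if "i \<in> {1..n}" for i using base space_\<Lambda> that by simp
  \<comment> \<open>The gradient with its arguments exchanged: for fixed \<open>y\<close> it is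
    continuous in the base point \<open>x\<close>, which is what the passage to closures
    requires.\<close>
  define G where "G y x = (\<Sum>i\<in>{1..n}. f (x(i := y i)) - f (x(i := base i)))" for y x
  have G_cont: "continuous_map ?X euclideanreal (G y)" if y: "y \<in> space P" for y
  proof -
    have upd: "continuous_map ?X euclideanreal (\<lambda>x. f (x(i := a)))" if "i \<in> {1..n}" "a \<in> mspace (K i)" for i a
    proof -
      have "continuous_map ?X ?X (\<lambda>x. x(i := a))"
        using that by (intro continuous_map_fun_upd) auto
      from continuous_map_compose[OF this f_cont] show ?thesis by (simp add: o_def)
    qed
    have "y i \<in> mspace (K i)" if "i \<in> {1..n}" for i using y that unfolding space_P by auto
    then show ?thesis
      unfolding G_def by (intro continuous_map_sum continuous_map_diff upd base finite_atLeastAtMost)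
  qed
  let ?grad = "\<lambda>x. restrict (discrete_grad n base f x) (prod_mspace n K)"
  have grad: "?grad x y = G y x" if "y \<in> space P" for x y
    using that by (simp add: discrete_grad_def partial_diff_def G_def space_P)
  let ?F = "funspace (prod_mspace n K) (euclidean_metric :: real metric)"
  obtain C where C: "finite C" "?grad ` prod_mspace n K \<subseteq> \<Union>C" "\<And>S. S \<in> C \<Longrightarrow> S \<subseteq> mspace ?F"
    "\<And>S. S \<in> C \<Longrightarrow> mdiameter ?F S < ennreal (\<delta> * real n)" "real (card C) \<le> exp (\<epsilon> * real n)"
    by (rule covering_number_leE[OF cov]) blast
  define N where "N = card C"
  have N: "N > 0" using C(1,2) P.not_empty by (auto simp: N_def card_gt_0_iff space_P)
  have ln_N: "ln (real N) \<le> \<epsilon> * real n" "0 \<le> ln (real N)"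
    using C(5) N by (auto simp: N_def ln_ge_iff intro!: order.trans[OF ln_mono[of "real (card C)" "exp (\<epsilon> * real n)"]])
  obtain e where e: "bij_betw e {0..<N} C" using ex_bij_betw_nat_finite[OF C(1)] unfolding N_def by blast
  have eC: "e k \<in> C" if "k < N" for k using e that by (auto simp: bij_betw_def)
  have "\<exists>r<\<delta> * real n. \<forall>g\<in>S. \<forall>h\<in>S. \<forall>y\<in>prod_mspace n K. \<bar>g y - h y\<bar> \<le> r" if "S \<in> C" for S
    by (rule funspace_diff_le[OF C(4)[OF that] C(3)[OF that]]) blast
  then obtain r where r: "\<And>S. S \<in> C \<Longrightarrow> r S < \<delta> * real n"
    "\<And>S g h y. S \<in> C \<Longrightarrow> g \<in> S \<Longrightarrow> h \<in> S \<Longrightarrow> y \<in> prod_mspace n K \<Longrightarrow> \<bar>g y - h y\<bar> \<le> r S"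
    by metis
  \<comment> \<open>The covering sets are arbitrary, so their preimages need not be measurable; the
    closures are, and they still cover.\<close>
  define A where "A k = ?X closure_of {x \<in> space P. ?grad x \<in> e k}" for k
  have A_sets: "A k \<in> sets P" for k unfolding A_def by (intro closed_meas) simp
  have A_cover: "(\<Union>k<N. A k) = space P"
  proof
    show "(\<Union>k<N. A k) \<subseteq> space P" using sets.sets_into_space[OF A_sets] by blast
    show "space P \<subseteq> (\<Union>k<N. A k)"
    proof
      fix x assume x: "x \<in> space P"
      then obtain S where S: "S \<in> C" "?grad x \<in> S" using C(2) unfolding space_P by blast
      then obtain k where k: "k < N" "e k = S" using e by (auto simp: bij_betw_def)
      have "{x \<in> space P. ?grad x \<in> e k} \<subseteq> A k"
        unfolding A_def by (intro closure_of_subset) (unfold top_X, blast)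
      then show "x \<in> (\<Union>k<N. A k)" using x S k by blast
    qed
  qed
  have osc: "\<bar>G y x - G y x'\<bar> \<le> r (e k)"
    if k: "k < N" and "x \<in> A k" "x' \<in> A k" and y: "y \<in> space P" for k x x' y
  proof (rule closure_of_oscillation_le[OF G_cont[OF y]])
    fix z z' assume "z \<in> {x \<in> space P. ?grad x \<in> e k}" "z' \<in> {x \<in> space P. ?grad x \<in> e k}"
    then have "?grad z \<in> e k" "?grad z' \<in> e k" by blast+
    then have "\<bar>?grad z y - ?grad z' y\<bar> \<le> r (e k)"
      by (rule r(2)[OF eC[OF k]]) (use y in \<open>simp only: space_P\<close>)
    then show "\<bar>G y z - G y z'\<bar> \<le> r (e k)" unfolding grad[OF y] .
  qed (use that in \<open>auto simp: A_def\<close>)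
  define a where "a = \<epsilon> + \<delta>"
  \<comment> \<open>The space is nonempty, so at least one covering set occurs; this forces
    \<epsilon> to be nonnegative and makes \<open>a\<close> positive.\<close>
  have "\<epsilon> * real n \<ge> 0" using ln_N by linarith
  then have "\<epsilon> \<ge> 0" using n by (simp add: zero_le_mult_iff)
  then have a: "a > 0" using \<delta> by (simp add: a_def)
  \<comment> \<open>The slack is set to \<open>\<delta> * real n\<close>, which supplies the
    \<delta> part of the linear term in the final bound.\<close>
  obtain t where t: "t > 0" "a * real n / t + t * L\<^sup>2 / (8 * real n) \<le> sqrt (a / 2) * L + \<delta> * real n"
    using exists_optimal_parameter[of a "\<delta> * real n" L "real n"] a \<delta> L n by auto
  define S where "S = (SUP \<xi>\<in>product_prob_measures n K. ereal (\<integral>x. f x \<partial>\<xi>) - kl_div \<xi> P)"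
  have S_upper: "ereal (\<integral>x. f x \<partial>Pi\<^sub>M {1..n} \<nu>) - kl_div (Pi\<^sub>M {1..n} \<nu>) P \<le> S"
    if "\<And>i. i \<in> {1..n} \<Longrightarrow> prob_space (\<nu> i)" "\<And>i. i \<in> {1..n} \<Longrightarrow> sets (\<nu> i) = sets (\<Lambda> i)" for \<nu>
    unfolding S_def using that sets_\<Lambda> by (intro SUP_upper) (auto simp: product_prob_measures_def)
  \<comment> \<open>The reference measure is itself an admissible product measure of divergence 0,
    so the supremum is not minus infinity; if it is infinite, the claim is trivial.\<close>
  have "kl_div P P = ereal 0" using P.kl_div_density[of "\<lambda>_. 1"] by (simp add: density_1)
  then have "ereal (\<integral>x. f x \<partial>P) \<le> S" using S_upper[of \<Lambda>] prob_\<Lambda> by simp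
  then consider s where "S = ereal s" | "S = \<infinity>" by (cases S) auto
  then have "ereal (ln (\<integral>x. exp (f x) \<partial>P)) \<le> S + ereal (a * real n) + ereal (sqrt (a / 2) * L)"
  proof cases
    case (1 s)
    have s: "(\<integral>x. f x \<partial>Pi\<^sub>M {1..n} \<nu>) - \<kappa> \<le> s"
      if "\<And>i. i \<in> {1..n} \<Longrightarrow> prob_space (\<nu> i)" "\<And>i. i \<in> {1..n} \<Longrightarrow> sets (\<nu> i) = sets (\<Lambda> i)"
        "kl_div (Pi\<^sub>M {1..n} \<nu>) P = ereal \<kappa>" for \<nu> \<kappa>
      using S_upper[OF that(1,2)] unfolding that(3) 1 by simp
    have "ln (\<integral>x. exp (f x) \<partial>P) \<le> s + ln (real N) + (ln (real N) + \<delta> * real n) / t + t * (\<Sum>i\<in>{1..n}. (L / real n)\<^sup>2) / 8"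
    proof (rule partition_bound[where A = A and r = "\<lambda>k. r (e k)" and base = base and c = "\<lambda>_. L / real n"])
      fix k x x' y assume "k < N" "x \<in> A k" "x' \<in> A k" "y \<in> space P"
      then show "\<bar>(\<Sum>i\<in>{1..n}. f (x(i := y i)) - f (x(i := base i))) - (\<Sum>i\<in>{1..n}. f (x'(i := y i)) - f (x'(i := base i)))\<bar> \<le> r (e k)"
        using osc[of k x x' y] by (simp only: G_def)
    qed (use f t diff base' s A_sets A_cover r(1) eC in auto)
    also have "t * (\<Sum>i\<in>{1..n}. (L / real n)\<^sup>2) / 8 = t * L\<^sup>2 / (8 * real n)"
      using n by (simp add: power2_eq_square)
    also have "s + ln (real N) + (ln (real N) + \<delta> * real n) / t + t * L\<^sup>2 / (8 * real n)
        \<le> s + \<epsilon> * real n + (\<epsilon> * real n + \<delta> * real n) / t + t * L\<^sup>2 / (8 * real n)"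
      using ln_N t by (intro add_mono divide_right_mono) auto
    also have "\<dots> = s + \<epsilon> * real n + (a * real n / t + t * L\<^sup>2 / (8 * real n))"
      by (simp add: a_def distrib_right)
    also have "\<dots> \<le> s + \<epsilon> * real n + (sqrt (a / 2) * L + \<delta> * real n)"
      using t(2) by simp
    also have "\<dots> = s + a * real n + sqrt (a / 2) * L" by (simp add: a_def distrib_right)
    finally show ?thesis by (simp add: 1)
  qed simp
  then show ?thesis unfolding lam_eq S_def a_def .
qed

end
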